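(* The vacuum vector $\Omega$ is cyclic for the family $(\langle\omega,h\rangle)_{h\in B_0(\mathbb R_+)}$: if $\mathbf A$ denotes the real algebra of operators on $\mathcal F$ generated by the identity and all $\langle\omega,h\rangle$, $h\in B_0(\mathbb R_+)$, then $\{P\Omega\mid P\in\mathbf A\}$ is dense in $\mathcal F$. Consequently the map $P\mapsto P\Omega$ extends by continuity to a unitary operator $I:L^2(\tau)\to\mathcal F$.
   Context: Setup. Let $\nu$ be a probability measure on $\mathbb R$ with compact support, $\mathbb R_+=[0,\infty)$. For $n\in\mathbb N$ let $T_n=\{(t_1,\dots,t_n)\in\mathbb R_+^n: t_1\ge t_2\ge\dots\ge t_n\}$ and $S_n=\{(t_1,s_1,\dots,t_n,s_n)\in(\mathbb R_+\times\mathbb R)^n:(t_1,\dots,t_n)\in T_n\}$. The monotone Fock space is $\mathcal F=\bigoplus_{n\ge0}\mathcal F^{(n)}$, $\mathcal F^{(0)}=\mathbb R$, $\mathcal F^{(n)}=L^2(S_n,dt_1\,d\nu(s_1)\cdots dt_n\,d\nu(s_n))$; $\Omega=(1,0,0,\dots)$ is the vacuum and $f^{(n)}\in\mathcal F^{(n)}$ is identified with the corresponding element of $\mathcal F$. $B_0(\mathbb R_+^n)$ is the space of bounded measurable functions on $\mathbb R_+^n$ with compact support; a sequence converges in $B_0(\mathbb R_+^n)$ if all terms vanish outside a common compact set and it converges uniformly. For $h\in B_0(\mathbb R_+)$ define bounded operators on $\mathcal F$: the creation operator $a^+(h)$, $a^+(h)\Omega=h$ (the function $(t,s)\mapsto h(t)$),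 $(a^+(h)f^{(n)})(t_1,s_1,\dots,t_{n+1},s_{n+1})=h(t_1)f^{(n)}(t_2,s_2,\dots,t_{n+1},s_{n+1})$; the neutral operator $a^0(h)$, $a^0(h)\Omega=0$, $(a^0(h)f^{(n)})(t_1,s_1,\dots,t_n,s_n)=h(t_1)s_1f^{(n)}(t_1,s_1,\dots,t_n,s_n)$; the annihilation operator $a^-(h)$, $a^-(h)\Omega=0$, $(a^-(h)f^{(n)})(t_1,s_1,\dots,t_{n-1},s_{n-1})=\int_{t_1}^\infty\int_{\mathbb R}h(u)f^{(n)}(u,v,t_1,s_1,\dots,t_{n-1},s_{n-1})\,d\nu(v)\,du$ (for $n=1$: $\int_0^\infty\int_{\mathbb R}h(u)f^{(1)}(u,v)\,d\nu(v)\,du\;\Omega$). Put $\langle\omega,h\rangle=a^+(h)+a^0(h)+a^-(h)$, a bounded self-adjoint operator. For $h_1,\dots,h_n\in B_0(\mathbb R_+)$ put $\langle\omega^{\otimes n},h_1\otimes\cdots\otimes h_n\rangle=\langle\omega,h_1\rangle\cdots\langle\omega,h_n\rangle$, where $(h_1\otimes\cdots\otimes h_n)(t_1,\dots,t_n)=h_1(t_1)\cdots h_n(t_n)$; this extends by linearity and strong continuity to a map $f^{(n)}\mapsto\langle\omega^{\otimes n},f^{(n)}\rangle$ from $B_0(\mathbb R_+^n)$ to bounded operators on $\mathcal F$ (monomials of order $n$; monomials of order $0$ are real multiples of the identity). Let $\mathbf P$ be the linear span of all monomials (polynomials of $\omega$) and $\mathbf P^{(n)}$ the span of monomials of order $\le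 n$. $L^2(\tau)$ is the Hilbert space completion of $\mathbf P$ modulo null vectors with respect to $(P_1,P_2)_{L^2(\tau)}=(P_1\Omega,P_2\Omega)_{\mathcal F}$. *)

theory Defs
  imports "HOL-Probability.Probability"
begin

text \<open>Representatives of elements of the monotone Fock space.
  A point of (R_+ x R)^n is encoded as a function x :: nat => real * real,
  where x i = (t_(i+1), s_(i+1)) for i < n (and x i = undefined for i >= n,
  as in the space of PiM). A Fock vector is a sequence f of functions,
  f n being the n-particle component (f 0 is a constant, the F^(0) part).\<close>

type_synonym fpoint = "nat \<Rightarrow> real \<times> real"
type_synonym fvec = "nat \<Rightarrow> fpoint \<Rightarrow> real"

definition pair_meas :: "real measure \<Rightarrow> (real \<times> real) measure" where
  "pair_meas nu = lborel \<Otimes>\<^sub>M nu"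

definition FM :: "real measure \<Rightarrow> nat \<Rightarrow> fpoint measure" where
  "FM nu n = PiM {..<n} (\<lambda>_. pair_meas nu)"

definition Sset :: "nat \<Rightarrow> fpoint set" where
  "Sset n = {x. (\<forall>i<n. 0 \<le> fst (x i)) \<and> (\<forall>i. Suc i < n \<longrightarrow> fst (x (Suc i)) \<le> fst (x i))}"

definition fock_dist2 :: "real measure \<Rightarrow> fvec \<Rightarrow> fvec \<Rightarrow> ennreal" where
  "fock_dist2 nu f g =
     (\<Sum>n. \<integral>\<^sup>+ x. indicator (Sset n) x * ennreal ((f n x - g n x)\<^sup>2) \<partial>FM nu n)"

definition fock :: "real measure \<Rightarrow> fvec set" where
  "fock nu = {f. (\<forall>n. f n \<in> borel_measurable (FM nu n)) \<and> fock_dist2 nu f (\<lambda>_ _. 0) < \<infinity>}"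

definition vacuum :: fvec where
  "vacuum = (\<lambda>n x. if n = 0 then 1 else 0)"

definition B0 :: "(real \<Rightarrow> real) set" where
  "B0 = {h. h \<in> borel_measurable borel \<and> bounded (range h) \<and>
             (\<exists>C. \<forall>t. t \<notin> {0..C} \<longrightarrow> h t = 0)}"

definition a_plus :: "(real \<Rightarrow> real) \<Rightarrow> fvec \<Rightarrow> fvec" where
  "a_plus h f = (\<lambda>n x. case n of 0 \<Rightarrow> 0 | Suc m \<Rightarrow> h (fst (x 0)) * f m (x \<circ> Suc))"

definition a_zero :: "(real \<Rightarrow> real) \<Rightarrow> fvec \<Rightarrow> fvec" where
  "a_zero h f = (\<lambda>n x. if n = 0 then 0 else h (fst (x 0)) * snd (x 0) * f n x)"

definition a_minus :: "real measure \<Rightarrow> (real \<Rightarrow> real) \<Rightarrow> fvec \<Rightarrow> fvec" where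
  "a_minus nu h f = (\<lambda>n x. \<integral> uv. indicator (Sset (Suc n)) (case_nat uv x) *
                               h (fst uv) * f (Suc n) (case_nat uv x) \<partial>pair_meas nu)"

definition omega_op :: "real measure \<Rightarrow> (real \<Rightarrow> real) \<Rightarrow> fvec \<Rightarrow> fvec" where
  "omega_op nu h f = (\<lambda>n x. a_plus h f n x + a_zero h f n x + a_minus nu h f n x)"

inductive_set op_alg :: "real measure \<Rightarrow> (fvec \<Rightarrow> fvec) set" for nu where
  alg_id: "(\<lambda>f. f) \<in> op_alg nu"
| alg_gen: "h \<in> B0 \<Longrightarrow> omega_op nu h \<in> op_alg nu"
| alg_add: "P \<in> op_alg nu \<Longrightarrow> Q \<in> op_alg nu \<Longrightarrow> (\<lambda>f n x. P f n x + Q f n x) \<in> op_alg nu"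
| alg_smult: "P \<in> op_alg nu \<Longrightarrow> (\<lambda>f n x. c * P f n x) \<in> op_alg nu"
| alg_comp: "P \<in> op_alg nu \<Longrightarrow> Q \<in> op_alg nu \<Longrightarrow> (\<lambda>f. P (Q f)) \<in> op_alg nu"

end

theory Submission
  imports Defs
begin

text \<open>Let \<open>M\<close> be the closure of the orbit of the vacuum; it is invariant under every
  \<open>\<langle>\<omega>, h\<rangle>\<close>, because these operators are bounded. One shows by induction that \<open>M\<close> contains each
  n-particle space. Suppose this holds up to \<open>n\<close> and let \<open>f\<close> have \<open>n\<close> particles. Then
  \<open>\<langle>\<omega>, h\<rangle> f\<close> is in \<open>M\<close>, and so are its neutral and annihilation parts, hence
  \<open>h \<otimes> f \<in> M\<close>. Powers of \<open>s\<close> arise from the neutral operator: if \<open>h s\<^sup>k \<otimes> f \<in> M\<close> for all \<open>h\<close>,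
  partition the time axis into cells \<open>\<Delta>\<^sub>j\<close> of length \<open>1/N\<close>, with indicators \<open>1\<^bsub>j\<^esub>\<close>, and consider
  \<open>\<Sum>\<^sub>j \<langle>\<omega>, h 1\<^bsub>j\<^esub>\<rangle> (1\<^bsub>j\<^esub> s\<^sup>k \<otimes> f)\<close>. The annihilation parts have \<open>n\<close> particles and lie in \<open>M\<close>,
  the neutral parts sum up to \<open>h s\<^sup>k\<^sup>+\<^sup>1 \<otimes> f\<close>, and the creation parts live near the diagonal
  \<open>t\<^sub>1 = t\<^sub>2\<close>, so that their squared norm is \<open>O(1/N)\<close>. As \<open>\<nu>\<close> has compact support, Weierstrass
  approximation replaces the powers by indicators of half-lines, and Dynkin's lemma gives all
  indicators of measurable sets with \<open>n + 1\<close> particles.\<close>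

section \<open>Integration over the particle spaces\<close>

lemma comp_case_nat_Suc [simp]: "case_nat uv y \<circ> Suc = y"
  by (auto simp: fun_eq_iff)

lemma case_nat_in_Sset_Suc: "case_nat uv y \<in> Sset (Suc n) \<Longrightarrow> y \<in> Sset n"
  unfolding Sset_def mem_Collect_eq by (metis Suc_less_eq old.nat.simps(5))

lemma power2_add_le: "(a + b)\<^sup>2 \<le> 2 * a\<^sup>2 + 2 * (b::real)\<^sup>2"
  using sum_squares_bound[of a b] by (simp add: power2_sum)

lemma B0_D:
  assumes "h \<in> B0"
  obtains B K where "h \<in> borel_measurable borel" "0 \<le> B" "\<And>t. \<bar>h t\<bar> \<le> B" "0 < K" "\<And>t. t \<notin> {0..K} \<Longrightarrow> h t = 0"
proof -
  obtain B where B: "\<And>t. \<bar>h t\<bar> \<le> B"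
    using assms by (auto simp: B0_def bounded_iff)
  obtain K where K: "\<And>t. t \<notin> {0..K} \<Longrightarrow> h t = 0"
    using assms by (auto simp: B0_def)
  have "t \<notin> {0..max 1 K} \<Longrightarrow> h t = 0" for t
    using K[of t] by (auto simp: max_def split: if_splits)
  moreover have "0 \<le> B" using B[of 0] by linarith
  ultimately show thesis
    using that[of B "max 1 K"] assms B by (auto simp: B0_def)
qed

lemma B0_mult_indicator:
  assumes "h \<in> B0" "A \<in> sets borel"
  shows "(\<lambda>t. h t * indicator A t) \<in> B0"
proof -
  obtain B K where h: "h \<in> borel_measurable borel" "0 \<le> B" "\<And>t. \<bar>h t\<bar> \<le> B" "\<And>t. t \<notin> {0..K} \<Longrightarrow> h t = 0"
    using B0_D[OF assms(1)] by metis
  have "\<bar>h t * indicator A t\<bar> \<le> B" for t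
    using h(2) h(3)[of t] by (auto simp: indicator_def)
  then have "bounded (range (\<lambda>t. h t * indicator A t))"
    by (auto simp: bounded_iff intro!: exI[of _ B])
  then show ?thesis using assms h by (auto simp: B0_def intro!: exI[of _ K])
qed

lemma indicator_B0: "indicator {0..R} \<in> B0"
proof -
  have "bounded (range (indicator {0..R} :: real \<Rightarrow> real))"
    by (auto simp: bounded_iff indicator_def intro!: exI[of _ 1])
  then show ?thesis
    by (auto simp: B0_def indicator_def intro!: exI[of _ R])
qed

lemma borel_measurable_fst_snd [measurable]:
  "fst \<in> borel_measurable (borel :: (real \<times> real) measure)"
  "snd \<in> borel_measurable (borel :: (real \<times> real) measure)"
  by (intro borel_measurable_continuous_onI continuous_intros)+

text \<open>Coordinate 0 is the newly created particle and \<open>x \<circ> Suc\<close> holds the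
  old ones. The product is not cut to \<open>Sset\<close>, because the norms ignore values outside
  it.\<close>

definition tens :: "(real \<times> real \<Rightarrow> real) \<Rightarrow> (fpoint \<Rightarrow> real) \<Rightarrow> fpoint \<Rightarrow> real" where
  "tens g u = (\<lambda>x. g (x 0) * u (x \<circ> Suc))"

definition emb :: "nat \<Rightarrow> (fpoint \<Rightarrow> real) \<Rightarrow> fvec" where
  "emb n u = (\<lambda>m x. if m = n then u x else 0)"

lemma ennreal_double: "0 \<le> a \<Longrightarrow> 2 * ennreal a = ennreal (2 * a)"
  by (simp add: ennreal_mult ennreal_numeral[symmetric] del: ennreal_numeral)

lemma ennreal_mult_small:
  assumes "L < (\<infinity>::ennreal)" "0 < (e::real)"
  obtains d :: real where "0 < d" "L * ennreal d \<le> ennreal e"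
proof -
  obtain l where l: "L = ennreal l" "0 \<le> l"
    using assms(1) by (cases L) auto
  \<comment> \<open>The denominator \<open>l + 1\<close> instead of \<open>l\<close> covers the case
    \<open>l = 0\<close>.\<close>
  have "L * ennreal (e / (l + 1)) = ennreal (l * (e / (l + 1)))"
    using l assms by (simp add: ennreal_mult[symmetric])
  also have "\<dots> \<le> ennreal e"
    using l assms by (intro ennreal_leI) (simp add: field_simps)
  finally show thesis
    using that[of "e / (l + 1)"] l assms by simp
qed

section \<open>Cells of length 1/N on the time axis\<close>

definition cell :: "nat \<Rightarrow> nat \<Rightarrow> real set" where
  "cell N j = {real j / real N ..< (real j + 1) / real N}"

text \<open>Half-open cells make the index of the cell a function of t, the floor of N t.
  Disjointness and covering below then become equations between indices.\<close>

lemma cell_iff: "0 < N \<Longrightarrow> t \<in> cell N j \<longleftrightarrow> 0 \<le> t \<and> nat \<lfloor>real N * t\<rfloor> = j"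
proof -
  assume N: "0 < N"
  have "t \<in> cell N j \<longleftrightarrow> real j \<le> real N * t \<and> real N * t < real j + 1"
    using N by (simp add: cell_def field_simps)
  also have "\<dots> \<longleftrightarrow> \<lfloor>real N * t\<rfloor> = int j"
    by (simp add: floor_eq_iff)
  also have "\<dots> \<longleftrightarrow> 0 \<le> t \<and> nat \<lfloor>real N * t\<rfloor> = j"
  proof
    assume *: "\<lfloor>real N * t\<rfloor> = int j"
    then have "0 \<le> real N * t" by linarith
    with * N show "0 \<le> t \<and> nat \<lfloor>real N * t\<rfloor> = j" by (simp add: zero_le_mult_iff)
  qed auto
  finally show ?thesis .
qed

lemma cell_sum_self:
  assumes "0 < N" "0 \<le> t" "t < real K"
  shows "(\<Sum>j<N * K. indicator (cell N j) t) = (1::real)"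
proof -
  have "real N * t < real (N * K)" using assms by simp
  then have "\<lfloor>real N * t\<rfloor> < int (N * K)"
    by (simp add: floor_less_iff del: of_nat_mult)
  then have "nat \<lfloor>real N * t\<rfloor> < N * K"
    using assms by (simp add: nat_less_iff del: of_nat_mult)
  moreover have "indicator (cell N j) t = (if j = nat \<lfloor>real N * t\<rfloor> then 1 else 0 :: real)" for j
    using assms by (auto simp: indicator_def cell_iff)
  ultimately show ?thesis by (simp add: sum.delta)
qed

text \<open>Disjointness leaves at most one index whose cell contains both points, and two points of
  one cell are at most 1/N apart. This confines the creation terms to a strip around the
  diagonal.\<close>

lemma cell_sum_pair:
  assumes "0 < N"
  shows "\<bar>\<Sum>j<J. indicator (cell N j) a * indicator (cell N j) b\<bar> \<le> (if \<bar>b - a\<bar> \<le> 1 / real N then 1 else (0::real))"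
proof (cases "\<exists>j. a \<in> cell N j \<and> b \<in> cell N j")
  case True
  then obtain k where k: "a \<in> cell N k" "b \<in> cell N k" by blast
  have "indicator (cell N j) a * indicator (cell N j) b = (if j = k then 1 else 0 :: real)" for j
    using k assms by (auto simp: indicator_def cell_iff)
  moreover have "\<bar>b - a\<bar> \<le> 1 / real N"
    using k assms by (auto simp: cell_def field_simps abs_le_iff)
  ultimately show ?thesis by (simp add: sum.delta)
next
  case False
  then have "indicator (cell N j) a * indicator (cell N j) b = (0::real)" for j
    by (auto simp: indicator_def)
  then show ?thesis by (simp only: sum.neutral_const) simp
qed

text \<open>Compact support enters as an almost sure bound on a single jump; all later bounds on the
  jump variable come from \<open>support\<close>.\<close>

locale monotone_fock = prob_space nu for nu :: "real measure" +
  fixes C :: real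
  assumes sets_nu [measurable_cong]: "sets nu = sets borel"
    and C_nonneg: "0 \<le> C"
    and support: "AE s in nu. \<bar>s\<bar> \<le> C"
begin

abbreviation "pM \<equiv> pair_meas nu"

lemma sets_pM [measurable_cong]: "sets pM = sets borel"
proof -
  have "sets pM = sets (borel \<Otimes>\<^sub>M borel)"
    unfolding pair_meas_def by (intro sets_pair_measure_cong) (simp_all add: sets_nu)
  then show ?thesis by (simp only: borel_prod)
qed

lemma space_pM [simp]: "space pM = UNIV"
  using sets_eq_imp_space_eq[OF sets_pM] by simp

lemma space_nu [simp]: "space nu = UNIV"
  using sets_eq_imp_space_eq[OF sets_nu] by simp

sublocale lebesgue_nu: pair_sigma_finite lborel nu ..

sublocale pM: sigma_finite_measure pM
  unfolding pair_meas_def by (rule lebesgue_nu.sigma_finite_measure_axioms)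

sublocale pMs: product_sigma_finite "\<lambda>_::nat. pM" ..

sublocale FM: sigma_finite_measure "FM nu n" for n
  unfolding FM_def by (rule pMs.sigma_finite) simp

sublocale pM_FM: pair_sigma_finite pM "FM nu n" for n ..

lemma space_FM: "space (FM nu n) = {..<n} \<rightarrow>\<^sub>E UNIV"
  by (simp add: FM_def space_PiM)

lemma measurable_case_nat_FM [measurable]:
  "(\<lambda>(uv, y). case_nat uv y) \<in> pM \<Otimes>\<^sub>M FM nu n \<rightarrow>\<^sub>M FM nu (Suc n)"
proof -
  have "(\<lambda>z i. case_nat (fst z) (snd z) i) \<in> pM \<Otimes>\<^sub>M PiM {..<n} (\<lambda>_. pM) \<rightarrow>\<^sub>M PiM {..<Suc n} (\<lambda>_. pM)"
  proof (rule measurable_PiM_single')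
    fix i assume "i \<in> {..<Suc n}"
    then show "(\<lambda>z. case_nat (fst z) (snd z) i) \<in> pM \<Otimes>\<^sub>M PiM {..<n} (\<lambda>_. pM) \<rightarrow>\<^sub>M pM"
      by (cases i) simp_all
  next
    \<comment> \<open>Points of a \<open>PiM\<close> space are \<open>undefined\<close> outside the
      index set, so prepending a particle must move the start of the undefined range from
      \<open>n\<close> to \<open>Suc n\<close>.\<close>
    have "case_nat uv y i = undefined" if "y \<in> space (PiM {..<n} (\<lambda>_. pM))" "\<not> i < Suc n" for uv y i
      using that by (cases i) (simp_all add: space_PiM PiE_def extensional_def)
    then show "(\<lambda>z i. case_nat (fst z) (snd z) i) \<in> space (pM \<Otimes>\<^sub>M PiM {..<n} (\<lambda>_. pM)) \<rightarrow> ({..<Suc n} \<rightarrow>\<^sub>E space pM)"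
      by (intro funcsetI) (force simp: space_pair_measure PiE_iff extensional_def)
  qed
  then show ?thesis
    by (simp add: FM_def split_beta')
qed

lemma measurable_case_nat_FM' [measurable]:
  "f \<in> M \<rightarrow>\<^sub>M pM \<Longrightarrow> g \<in> M \<rightarrow>\<^sub>M FM nu n \<Longrightarrow> (\<lambda>z. case_nat (f z) (g z)) \<in> M \<rightarrow>\<^sub>M FM nu (Suc n)"
  using measurable_compose[OF measurable_Pair[of f M pM g "FM nu n"] measurable_case_nat_FM]
  by (simp only: split_conv)

lemma measurable_tail_FM [measurable]: "(\<lambda>x. x \<circ> Suc) \<in> FM nu (Suc n) \<rightarrow>\<^sub>M FM nu n"
  unfolding FM_def comp_def
  by (rule measurable_PiM_single'[where f="\<lambda>i x. x (Suc i)"])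
     (auto simp: space_PiM PiE_def extensional_def intro!: measurable_component_singleton)

lemma measurable_component_FM: "i < n \<Longrightarrow> (\<lambda>x. x i) \<in> FM nu n \<rightarrow>\<^sub>M borel"
proof -
  assume "i < n"
  then have "(\<lambda>x. x i) \<in> FM nu n \<rightarrow>\<^sub>M pM"
    unfolding FM_def by (intro measurable_component_singleton) auto
  then show ?thesis by (simp add: measurable_cong_sets[OF refl sets_pM])
qed

lemma measurable_head_FM [measurable]: "(\<lambda>x. x 0) \<in> FM nu (Suc n) \<rightarrow>\<^sub>M borel"
  by (rule measurable_component_FM) simp

text \<open>A product measure is determined by its values on boxes, and prepending pulls a box back
  to the product of its first side with the box of the remaining sides. This identity carries the
  recursion over the number of particles.\<close>

lemma FM_Suc: "distr (pM \<Otimes>\<^sub>M FM nu n) (FM nu (Suc n)) (\<lambda>(uv, y). case_nat uv y) = FM nu (Suc n)"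
  (is "?D = _")
proof -
  have "?D = PiM {..<Suc n} (\<lambda>_. pM)"
  proof (rule pMs.PiM_eqI)
    fix A :: "nat \<Rightarrow> (real \<times> real) set"
    assume A: "\<And>i. i \<in> {..<Suc n} \<Longrightarrow> A i \<in> sets pM"
    have box: "Pi\<^sub>E {..<Suc n} A \<in> sets (FM nu (Suc n))"
      unfolding FM_def using A by (intro sets_PiM_I_finite) auto
    have tail: "Pi\<^sub>E {..<n} (\<lambda>i. A (Suc i)) \<in> sets (FM nu n)"
      unfolding FM_def using A by (intro sets_PiM_I_finite) auto
    have pre: "(\<lambda>(uv, y). case_nat uv y) -` Pi\<^sub>E {..<Suc n} A \<inter> space (pM \<Otimes>\<^sub>M FM nu n)
        = A 0 \<times> Pi\<^sub>E {..<n} (\<lambda>i. A (Suc i))"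
      by (auto simp: space_pair_measure space_FM PiE_iff extensional_def less_Suc_eq_0_disj Ball_def split: nat.splits)
    have "emeasure ?D (Pi\<^sub>E {..<Suc n} A) = emeasure (pM \<Otimes>\<^sub>M FM nu n) (A 0 \<times> Pi\<^sub>E {..<n} (\<lambda>i. A (Suc i)))"
      using box by (simp add: emeasure_distr pre)
    also have "\<dots> = emeasure pM (A 0) * emeasure (FM nu n) (Pi\<^sub>E {..<n} (\<lambda>i. A (Suc i)))"
      using A tail by (intro FM.emeasure_pair_measure_Times) auto
    also have "\<dots> = (\<Prod>i<Suc n. emeasure pM (A i))"
      unfolding FM_def prod.lessThan_Suc_shift using A by (subst pMs.emeasure_PiM) auto
    finally show "emeasure ?D (Pi\<^sub>E {..<Suc n} A) = (\<Prod>i<Suc n. emeasure pM (A i))" .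
  qed (auto simp: FM_def)
  then show ?thesis by (simp add: FM_def)
qed

lemma nn_integral_FM_Suc:
  assumes [measurable]: "f \<in> borel_measurable (FM nu (Suc n))"
  shows "(\<integral>\<^sup>+x. f x \<partial>FM nu (Suc n)) = (\<integral>\<^sup>+uv. \<integral>\<^sup>+y. f (case_nat uv y) \<partial>FM nu n \<partial>pM)"
proof -
  have "(\<integral>\<^sup>+x. f x \<partial>FM nu (Suc n)) = (\<integral>\<^sup>+x. f x \<partial>distr (pM \<Otimes>\<^sub>M FM nu n) (FM nu (Suc n)) (\<lambda>(uv, y). case_nat uv y))"
    by (simp only: FM_Suc)
  also have "\<dots> = (\<integral>\<^sup>+z. f (case z of (uv, y) \<Rightarrow> case_nat uv y) \<partial>(pM \<Otimes>\<^sub>M FM nu n))"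
    by (subst nn_integral_distr) auto
  also have "\<dots> = (\<integral>\<^sup>+uv. \<integral>\<^sup>+y. f (case_nat uv y) \<partial>FM nu n \<partial>pM)"
    by (subst FM.nn_integral_fst[symmetric]) auto
  finally show ?thesis .
qed

text \<open>Here the tail is the outer variable: the annihilation operator integrates out the head
  while the tail is held fixed.\<close>

lemma nn_integral_FM_Suc':
  assumes [measurable]: "f \<in> borel_measurable (FM nu (Suc n))"
  shows "(\<integral>\<^sup>+x. f x \<partial>FM nu (Suc n)) = (\<integral>\<^sup>+y. \<integral>\<^sup>+uv. f (case_nat uv y) \<partial>pM \<partial>FM nu n)"
  unfolding nn_integral_FM_Suc[OF assms]
proof (rule pM_FM.Fubini'[symmetric])
  show "(\<lambda>(uv, y). f (case_nat uv y)) \<in> borel_measurable (pM \<Otimes>\<^sub>M FM nu n)"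
    using measurable_compose[OF measurable_case_nat_FM assms] by (simp add: split_beta')
qed

lemma AE_pM_snd: "AE uv in pM. \<bar>snd uv\<bar> \<le> C"
  unfolding pair_meas_def
proof (rule lebesgue_nu.AE_pair_measure)
  show "{uv \<in> space (lborel \<Otimes>\<^sub>M nu). \<bar>snd uv\<bar> \<le> C} \<in> sets (lborel \<Otimes>\<^sub>M nu)"
    by measurable
qed (use support in simp)

lemma AE_FM_head: "AE x in FM nu (Suc n). \<bar>snd (x 0)\<bar> \<le> C"
proof -
  have "AE z in pM \<Otimes>\<^sub>M FM nu n. \<bar>snd (fst z)\<bar> \<le> C"
  proof (rule pM_FM.AE_pair_measure)
    show "AE uv in pM. AE y in FM nu n. \<bar>snd (fst (uv, y))\<bar> \<le> C"
      using AE_pM_snd by eventually_elim simp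
  qed measurable
  then have "AE x in distr (pM \<Otimes>\<^sub>M FM nu n) (FM nu (Suc n)) (\<lambda>(uv, y). case_nat uv y). \<bar>snd (x 0)\<bar> \<le> C"
    by (subst AE_distr_iff) (auto simp: split_beta')
  then show ?thesis by (simp only: FM_Suc)
qed

text \<open>\<open>Sset n\<close> says nothing about coordinates from \<open>n\<close> on, so it has
  to be intersected with the space of extensional functions to become a member of the
  sigma-algebra.\<close>

lemma measurable_Sset [measurable]: "Sset n \<inter> space (FM nu n) \<in> sets (FM nu n)"
proof -
  have [measurable]: "(\<lambda>x. fst (x i)) \<in> borel_measurable (FM nu n)" if "i < n" for i
    using measurable_compose[OF measurable_component_FM[OF that] borel_measurable_fst_snd(1)] .
  have "{x \<in> space (FM nu n). (\<forall>i\<in>{..<n}. 0 \<le> fst (x i)) \<and> (\<forall>i\<in>{i. Suc i < n}. fst (x (Suc i)) \<le> fst (x i))} \<in> sets (FM nu n)"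
    by (intro sets.sets_Collect_conj sets.sets_Collect_finite_All
        finite_subset[of "{i. Suc i < n}" "{..<n}"]) auto
  also have "{x \<in> space (FM nu n). (\<forall>i\<in>{..<n}. 0 \<le> fst (x i)) \<and> (\<forall>i\<in>{i. Suc i < n}. fst (x (Suc i)) \<le> fst (x i))} = Sset n \<inter> space (FM nu n)"
    by (auto simp: Sset_def)
  finally show ?thesis .
qed

lemma measurable_indicator_Sset [measurable]:
  "(indicator (Sset n) :: _ \<Rightarrow> ennreal) \<in> borel_measurable (FM nu n)"
  "(indicator (Sset n) :: _ \<Rightarrow> real) \<in> borel_measurable (FM nu n)"
  by (rule borel_measurable_indicator_iff[THEN iffD2, OF measurable_Sset])+

section \<open>Norms of components\<close>

lemma borel_measurable_pM [simp]: "borel_measurable pM = borel_measurable borel"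
  by (rule measurable_cong_sets) (simp_all add: sets_pM)

lemma borel_measurable_nu [simp]: "borel_measurable nu = borel_measurable borel"
  by (rule measurable_cong_sets) (simp_all add: sets_nu)

lemma measurable_tens [measurable]:
  assumes [measurable]: "g \<in> borel_measurable borel" "u \<in> borel_measurable (FM nu n)"
  shows "tens g u \<in> borel_measurable (FM nu (Suc n))"
  unfolding tens_def by measurable

definition comp_norm2 :: "nat \<Rightarrow> (fpoint \<Rightarrow> real) \<Rightarrow> ennreal" where
  "comp_norm2 n u = (\<integral>\<^sup>+x. indicator (Sset n) x * ennreal ((u x)\<^sup>2) \<partial>FM nu n)"

text \<open>These are functions rather than classes; their values outside \<open>Sset n\<close>
  matter only for measurability.\<close>

definition L2S :: "nat \<Rightarrow> (fpoint \<Rightarrow> real) set" where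
  "L2S n = {u \<in> borel_measurable (FM nu n). comp_norm2 n u < \<infinity>}"

definition fock_norm2 :: "fvec \<Rightarrow> ennreal" where
  "fock_norm2 f = (\<Sum>n. comp_norm2 n (f n))"

lemma fock_dist2_eq: "fock_dist2 nu f g = fock_norm2 (\<lambda>n x. f n x - g n x)"
  by (simp add: fock_dist2_def fock_norm2_def comp_norm2_def)

lemma fock_iff: "f \<in> fock nu \<longleftrightarrow> (\<forall>n. f n \<in> borel_measurable (FM nu n)) \<and> fock_norm2 f < \<infinity>"
  by (simp add: fock_def fock_dist2_eq)

lemma fock_measurable: "f \<in> fock nu \<Longrightarrow> f n \<in> borel_measurable (FM nu n)"
  by (simp add: fock_iff)

lemma L2S_measurable: "u \<in> L2S n \<Longrightarrow> u \<in> borel_measurable (FM nu n)"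
  by (simp add: L2S_def)

lemma comp_norm2_mono_AE:
  assumes "AE x in FM nu n. x \<in> Sset n \<longrightarrow> \<bar>u x\<bar> \<le> \<bar>v x\<bar>"
  shows "comp_norm2 n u \<le> comp_norm2 n v"
  unfolding comp_norm2_def
proof (rule nn_integral_mono_AE)
  show "AE x in FM nu n. indicator (Sset n) x * ennreal ((u x)\<^sup>2) \<le> indicator (Sset n) x * ennreal ((v x)\<^sup>2)"
    using assms
  proof eventually_elim
    case (elim x)
    then show ?case by (auto simp: indicator_def intro!: ennreal_leI) (simp add: abs_le_square_iff)
  qed
qed

text \<open>Working with squared norms avoids square roots: (a + b)^2 \<le> 2 a^2 + 2 b^2 takes the
  place of Minkowski's inequality, at the price of factors 2 in later estimates.\<close>

lemma comp_norm2_add: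
  assumes [measurable]: "u \<in> borel_measurable (FM nu n)" "v \<in> borel_measurable (FM nu n)"
  shows "comp_norm2 n (\<lambda>x. u x + v x) \<le> 2 * comp_norm2 n u + 2 * comp_norm2 n v"
proof -
  have "ennreal ((a + b)\<^sup>2) \<le> 2 * ennreal (a\<^sup>2) + 2 * ennreal (b\<^sup>2)" for a b
    using ennreal_leI[OF power2_add_le[of a b]] by (simp add: ennreal_plus ennreal_mult)
  then have "comp_norm2 n (\<lambda>x. u x + v x) \<le> (\<integral>\<^sup>+x. 2 * (indicator (Sset n) x * ennreal ((u x)\<^sup>2)) + 2 * (indicator (Sset n) x * ennreal ((v x)\<^sup>2)) \<partial>FM nu n)"
    unfolding comp_norm2_def by (intro nn_integral_mono) (simp add: indicator_def)
  also have "\<dots> = 2 * comp_norm2 n u + 2 * comp_norm2 n v"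
    unfolding comp_norm2_def by (subst nn_integral_add) (simp_all add: nn_integral_cmult)
  finally show ?thesis .
qed

lemma comp_norm2_scale:
  assumes [measurable]: "u \<in> borel_measurable (FM nu n)"
  shows "comp_norm2 n (\<lambda>x. c * u x) = ennreal (c\<^sup>2) * comp_norm2 n u"
  unfolding comp_norm2_def
  by (subst nn_integral_cmult[symmetric])
     (auto simp: power_mult_distrib ennreal_mult ac_simps intro!: nn_integral_cong)

lemma comp_norm2_zero [simp]: "comp_norm2 n (\<lambda>_. 0) = 0"
  by (simp add: comp_norm2_def)

text \<open>Membership of \<open>case_nat uv y\<close> in \<open>Sset (Suc n)\<close> is weakened to
  membership of \<open>y\<close> in \<open>Sset n\<close>. Forgetting that the head is the latest
  particle costs equality, but turns the inner integral into a norm with \<open>n\<close>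
  particles.\<close>

lemma comp_norm2_section:
  assumes [measurable]: "(\<lambda>x. F (x 0) (x \<circ> Suc)) \<in> borel_measurable (FM nu (Suc n))"
  shows "comp_norm2 (Suc n) (\<lambda>x. F (x 0) (x \<circ> Suc)) \<le> (\<integral>\<^sup>+uv. comp_norm2 n (F uv) \<partial>pM)"
proof -
  have "comp_norm2 (Suc n) (\<lambda>x. F (x 0) (x \<circ> Suc)) = (\<integral>\<^sup>+uv. \<integral>\<^sup>+y. indicator (Sset (Suc n)) (case_nat uv y) * ennreal ((F uv y)\<^sup>2) \<partial>FM nu n \<partial>pM)"
    unfolding comp_norm2_def
    by (subst nn_integral_FM_Suc[OF borel_measurable_times_ennreal[OF measurable_indicator_Sset(1)
          measurable_compose[OF borel_measurable_power[OF assms] measurable_ennreal]]]) simp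
  also have "\<dots> \<le> (\<integral>\<^sup>+uv. comp_norm2 n (F uv) \<partial>pM)"
    unfolding comp_norm2_def by (intro nn_integral_mono) (auto simp: indicator_def dest: case_nat_in_Sset_Suc)
  finally show ?thesis .
qed

lemma comp_norm2_tens:
  assumes [measurable]: "g \<in> borel_measurable borel" "u \<in> borel_measurable (FM nu n)"
  shows "comp_norm2 (Suc n) (tens g u) \<le> (\<integral>\<^sup>+uv. ennreal ((g uv)\<^sup>2) \<partial>pM) * comp_norm2 n u"
proof -
  have "(\<lambda>x. g (x 0) * u (x \<circ> Suc)) \<in> borel_measurable (FM nu (Suc n))"
    by measurable
  then have "comp_norm2 (Suc n) (\<lambda>x. g (x 0) * u (x \<circ> Suc)) \<le> (\<integral>\<^sup>+uv. comp_norm2 n (\<lambda>y. g uv * u y) \<partial>pM)"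
    by (rule comp_norm2_section[where F="\<lambda>uv y. g uv * u y"])
  also have "\<dots> = (\<integral>\<^sup>+uv. ennreal ((g uv)\<^sup>2) \<partial>pM) * comp_norm2 n u"
    by (simp add: comp_norm2_scale nn_integral_multc)
  finally show ?thesis by (simp add: tens_def)
qed

lemma nn_integral_pM_mult:
  assumes [measurable]: "\<phi> \<in> borel_measurable borel" "\<psi> \<in> borel_measurable borel"
  shows "(\<integral>\<^sup>+uv. \<phi> (fst uv) * \<psi> (snd uv) \<partial>pM) = (\<integral>\<^sup>+t. \<phi> t \<partial>lborel) * (\<integral>\<^sup>+s. \<psi> s \<partial>nu)"
  unfolding pair_meas_def
  by (subst nn_integral_fst[symmetric]) (simp_all add: nn_integral_cmult nn_integral_multc)

lemma nn_integral_B0_sq_finite: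
  assumes "h \<in> B0"
  shows "(\<integral>\<^sup>+t. ennreal ((h t)\<^sup>2) \<partial>lborel) < \<infinity>"
proof -
  obtain B K where h: "h \<in> borel_measurable borel" "0 \<le> B" "\<And>t. \<bar>h t\<bar> \<le> B" "0 < K" "\<And>t. t \<notin> {0..K} \<Longrightarrow> h t = 0"
    using B0_D[OF assms] by metis
  have "(h t)\<^sup>2 \<le> B\<^sup>2" for t
    using h(2) h(3)[of t] by (simp add: abs_le_square_iff[symmetric])
  then have "ennreal ((h t)\<^sup>2) \<le> ennreal (B\<^sup>2) * indicator {0..K} t" for t
    using h(5)[of t] by (auto simp: indicator_def intro!: ennreal_leI)
  then have "(\<integral>\<^sup>+t. ennreal ((h t)\<^sup>2) \<partial>lborel) \<le> (\<integral>\<^sup>+t. ennreal (B\<^sup>2) * indicator {0..K} t \<partial>lborel)"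
    by (intro nn_integral_mono)
  also have "\<dots> < \<infinity>"
    using h(4) by (simp add: nn_integral_cmult_indicator ennreal_mult_less_top)
  finally show ?thesis .
qed

lemma nn_integral_pM_fst:
  assumes [measurable]: "\<phi> \<in> borel_measurable borel"
  shows "(\<integral>\<^sup>+uv. \<phi> (fst uv) \<partial>pM) = (\<integral>\<^sup>+t. \<phi> t \<partial>lborel)"
  using nn_integral_pM_mult[of \<phi> "\<lambda>_. 1"] emeasure_space_1 by simp

lemma fock_norm2_add:
  assumes "\<And>n. f n \<in> borel_measurable (FM nu n)" "\<And>n. g n \<in> borel_measurable (FM nu n)"
  shows "fock_norm2 (\<lambda>n x. f n x + g n x) \<le> 2 * fock_norm2 f + 2 * fock_norm2 g"
proof -
  have "fock_norm2 (\<lambda>n x. f n x + g n x) \<le> (\<Sum>n. 2 * comp_norm2 n (f n) + 2 * comp_norm2 n (g n))"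
    unfolding fock_norm2_def using assms by (intro suminf_le comp_norm2_add) auto
  also have "\<dots> = 2 * fock_norm2 f + 2 * fock_norm2 g"
    unfolding fock_norm2_def by (simp add: suminf_add[symmetric] ennreal_suminf_cmult)
  finally show ?thesis .
qed

lemma fock_norm2_scale:
  assumes "\<And>n. f n \<in> borel_measurable (FM nu n)"
  shows "fock_norm2 (\<lambda>n x. c * f n x) = ennreal (c\<^sup>2) * fock_norm2 f"
  unfolding fock_norm2_def using assms by (simp add: comp_norm2_scale ennreal_suminf_cmult)

lemma fock_add:
  assumes "f \<in> fock nu" "g \<in> fock nu"
  shows "(\<lambda>n x. f n x + g n x) \<in> fock nu"
proof -
  have "fock_norm2 (\<lambda>n x. f n x + g n x) \<le> 2 * fock_norm2 f + 2 * fock_norm2 g"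
    using assms by (intro fock_norm2_add) (auto simp: fock_iff)
  also have "\<dots> < \<infinity>"
    using assms by (auto simp: fock_iff ennreal_mult_less_top)
  finally show ?thesis
    using assms[THEN fock_measurable] by (simp add: fock_iff borel_measurable_add)
qed

lemma fock_scale: "f \<in> fock nu \<Longrightarrow> (\<lambda>n x. c * f n x) \<in> fock nu"
  by (auto simp: fock_iff fock_norm2_scale ennreal_mult_less_top intro: borel_measurable_times)

lemma fock_diff:
  assumes "f \<in> fock nu" "g \<in> fock nu"
  shows "(\<lambda>n x. f n x - g n x) \<in> fock nu"
  using fock_add[OF assms(1) fock_scale[OF assms(2), of "-1"]] by simp

lemma fock_dist2_triangle:
  assumes "f \<in> fock nu" "g \<in> fock nu" "h \<in> fock nu"
  shows "fock_dist2 nu f h \<le> 2 * fock_dist2 nu f g + 2 * fock_dist2 nu g h"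
  unfolding fock_dist2_eq
  using fock_norm2_add[of "\<lambda>n x. f n x - g n x" "\<lambda>n x. g n x - h n x"] assms[THEN fock_measurable]
  by (simp add: borel_measurable_diff)

text \<open>The empty product is the unit point mass at the function that is
  \<open>undefined\<close> everywhere.\<close>

lemma comp_norm2_0: "comp_norm2 0 u = ennreal ((u (\<lambda>_. undefined))\<^sup>2)"
proof -
  have "(\<integral>\<^sup>+x. g x \<partial>FM nu 0) = g (\<lambda>_. undefined)" for g
    unfolding FM_def by (simp add: PiM_empty nn_integral_count_space_finite)
  then show ?thesis by (simp add: comp_norm2_def Sset_def)
qed

lemma emb_norm2: "fock_norm2 (emb n u) = comp_norm2 n u"
proof -
  have "(\<Sum>m. comp_norm2 m (emb n u m)) = (\<Sum>m\<in>{n}. comp_norm2 m (emb n u m))"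
    by (rule suminf_finite) (simp_all add: emb_def)
  then show ?thesis by (simp add: fock_norm2_def emb_def)
qed

lemma emb_in_fock [simp]: "emb n u \<in> fock nu \<longleftrightarrow> u \<in> L2S n"
proof -
  have "(\<forall>m. emb n u m \<in> borel_measurable (FM nu m)) \<longleftrightarrow> u \<in> borel_measurable (FM nu n)"
  proof
    assume "\<forall>m. emb n u m \<in> borel_measurable (FM nu m)"
    then show "u \<in> borel_measurable (FM nu n)"
      by (auto simp: emb_def dest: spec[of _ n])
  next
    assume "u \<in> borel_measurable (FM nu n)"
    then show "\<forall>m. emb n u m \<in> borel_measurable (FM nu m)"
      by (metis (no_types) borel_measurable_const emb_def ext)
  qed
  then show ?thesis
    by (simp add: fock_iff emb_norm2 L2S_def)
qed

lemma emb_diff: "(\<lambda>m x. emb n u m x - emb n v m x) = emb n (\<lambda>x. u x - v x)"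
  by (auto simp: emb_def fun_eq_iff)

lemma fock_dist2_emb: "fock_dist2 nu (emb n u) (emb n v) = comp_norm2 n (\<lambda>x. u x - v x)"
  by (simp add: fock_dist2_eq emb_diff emb_norm2)

lemma component_L2S:
  assumes "f \<in> fock nu" shows "f n \<in> L2S n"
proof -
  have "comp_norm2 n (f n) = (\<Sum>m\<in>{n}. comp_norm2 m (f m))" by simp
  also have "\<dots> \<le> fock_norm2 f" unfolding fock_norm2_def by (rule sum_le_suminf) auto
  finally show ?thesis using assms by (auto simp: fock_iff L2S_def)
qed

lemma vacuum_eq: "vacuum = emb 0 (\<lambda>_. 1)"
  by (auto simp: vacuum_def emb_def fun_eq_iff)

lemma vacuum_fock: "vacuum \<in> fock nu"
  unfolding vacuum_eq emb_in_fock by (simp add: L2S_def comp_norm2_0)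

section \<open>Boundedness of the field operators\<close>

lemma a_plus_measurable:
  assumes "h \<in> B0" "\<And>m. f m \<in> borel_measurable (FM nu m)"
  shows "a_plus h f n \<in> borel_measurable (FM nu n)"
proof (cases n)
  case (Suc m)
  have [measurable]: "h \<in> borel_measurable borel" "f m \<in> borel_measurable (FM nu m)"
    using assms by (auto simp: B0_def)
  show ?thesis unfolding Suc a_plus_def by simp
qed (simp add: a_plus_def)

lemma a_zero_measurable:
  assumes "h \<in> B0" "\<And>m. f m \<in> borel_measurable (FM nu m)"
  shows "a_zero h f n \<in> borel_measurable (FM nu n)"
proof (cases n)
  case (Suc m)
  have [measurable]: "h \<in> borel_measurable borel" "f (Suc m) \<in> borel_measurable (FM nu (Suc m))"
    using assms by (auto simp: B0_def)
  show ?thesis unfolding Suc a_zero_def by simp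
qed (simp add: a_zero_def)

lemma measurable_case_nat_swap [measurable]:
  "(\<lambda>(y, uv). case_nat uv y) \<in> FM nu n \<Otimes>\<^sub>M pM \<rightarrow>\<^sub>M FM nu (Suc n)"
  unfolding split_beta' by (rule measurable_case_nat_FM'[OF measurable_snd measurable_fst])

lemma a_minus_measurable:
  assumes "h \<in> B0" "\<And>m. f m \<in> borel_measurable (FM nu m)"
  shows "a_minus nu h f n \<in> borel_measurable (FM nu n)"
proof -
  have [measurable]: "h \<in> borel_measurable borel" "f (Suc n) \<in> borel_measurable (FM nu (Suc n))"
    using assms by (auto simp: B0_def)
  have "(\<lambda>x. indicator (Sset (Suc n)) x * h (fst (x 0)) * f (Suc n) x) \<in> borel_measurable (FM nu (Suc n))"
    by measurable
  from measurable_compose[OF measurable_case_nat_swap this]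
  have "(\<lambda>(x, uv). indicator (Sset (Suc n)) (case_nat uv x) * h (fst uv) * f (Suc n) (case_nat uv x))
     \<in> borel_measurable (FM nu n \<Otimes>\<^sub>M pM)"
    by (simp add: split_beta')
  then show ?thesis
    unfolding a_minus_def by (rule pM.borel_measurable_lebesgue_integral)
qed

definition B0_norm2 :: "(real \<Rightarrow> real) \<Rightarrow> ennreal" where
  "B0_norm2 h = (\<integral>\<^sup>+t. ennreal ((h t)\<^sup>2) \<partial>lborel)"

lemma B0_norm2_finite: "h \<in> B0 \<Longrightarrow> B0_norm2 h < \<infinity>"
  unfolding B0_norm2_def by (rule nn_integral_B0_sq_finite)

lemma suminf_ennreal_shift: "f 0 = 0 \<Longrightarrow> (\<Sum>n. f n) = (\<Sum>n. f (Suc n) :: ennreal)"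
  using suminf_offset[of f 1] by simp

lemma a_plus_norm2:
  assumes "h \<in> B0" "\<And>m. f m \<in> borel_measurable (FM nu m)"
  shows "fock_norm2 (a_plus h f) \<le> B0_norm2 h * fock_norm2 f"
proof -
  have [measurable]: "h \<in> borel_measurable borel" using assms by (auto simp: B0_def)
  have "comp_norm2 0 (a_plus h f 0) = 0"
    by (simp add: a_plus_def)
  then have "fock_norm2 (a_plus h f) = (\<Sum>n. comp_norm2 (Suc n) (a_plus h f (Suc n)))"
    unfolding fock_norm2_def by (rule suminf_ennreal_shift)
  also have "\<dots> \<le> (\<Sum>n. B0_norm2 h * comp_norm2 n (f n))"
  proof (intro suminf_le)
    fix n
    have "comp_norm2 (Suc n) (tens (\<lambda>uv. h (fst uv)) (f n)) \<le> (\<integral>\<^sup>+uv. ennreal ((h (fst uv))\<^sup>2) \<partial>pM) * comp_norm2 n (f n)"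
      using assms(2) by (intro comp_norm2_tens) auto
    also have "(\<integral>\<^sup>+uv. ennreal ((h (fst uv))\<^sup>2) \<partial>pM) = B0_norm2 h"
      unfolding B0_norm2_def by (rule nn_integral_pM_fst) simp
    finally show "comp_norm2 (Suc n) (a_plus h f (Suc n)) \<le> B0_norm2 h * comp_norm2 n (f n)"
      by (simp add: tens_def a_plus_def)
  qed auto
  finally show ?thesis by (simp add: fock_norm2_def ennreal_suminf_cmult)
qed

text \<open>The operator multiplies by \<open>h t * s\<close>, and the support of \<open>nu\<close>
  bounds this factor by \<open>B * C\<close> almost everywhere.\<close>

lemma a_zero_norm2:
  assumes "\<And>t. \<bar>h t\<bar> \<le> B" "0 \<le> B" "\<And>m. f m \<in> borel_measurable (FM nu m)"
  shows "fock_norm2 (a_zero h f) \<le> ennreal ((B * C)\<^sup>2) * fock_norm2 f"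
proof -
  have "comp_norm2 n (a_zero h f n) \<le> ennreal ((B * C)\<^sup>2) * comp_norm2 n (f n)" for n
  proof (cases n)
    case (Suc m)
    have "comp_norm2 n (a_zero h f n) \<le> comp_norm2 n (\<lambda>x. (B * C) * f n x)"
    proof (rule comp_norm2_mono_AE)
      show "AE x in FM nu n. x \<in> Sset n \<longrightarrow> \<bar>a_zero h f n x\<bar> \<le> \<bar>B * C * f n x\<bar>"
        unfolding Suc using AE_FM_head[of m]
      proof eventually_elim
        case (elim x)
        have "\<bar>h (fst (x 0))\<bar> * \<bar>snd (x 0)\<bar> * \<bar>f (Suc m) x\<bar> \<le> B * C * \<bar>f (Suc m) x\<bar>"
          using assms(1,2) elim by (intro mult_right_mono mult_mono) auto
        then show ?case
          using assms(2) C_nonneg by (simp add: a_zero_def abs_mult)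
      qed
    qed
    also have "\<dots> = ennreal ((B * C)\<^sup>2) * comp_norm2 n (f n)"
      by (rule comp_norm2_scale[OF assms(3)])
    finally show ?thesis .
  qed (simp add: a_zero_def)
  then show ?thesis
    unfolding fock_norm2_def ennreal_suminf_cmult[symmetric] by (intro suminf_le) auto
qed

abbreviation minus_kernel :: "nat \<Rightarrow> (real \<Rightarrow> real) \<Rightarrow> (fpoint \<Rightarrow> real) \<Rightarrow> fpoint \<Rightarrow> real \<times> real \<Rightarrow> real" where
  "minus_kernel n h u y uv \<equiv> indicator (Sset (Suc n)) (case_nat uv y) * h (fst uv) * u (case_nat uv y)"

lemma measurable_section:
  assumes "u \<in> FM nu (Suc n) \<rightarrow>\<^sub>M N" "y \<in> space (FM nu n)"
  shows "(\<lambda>uv. u (case_nat uv y)) \<in> pM \<rightarrow>\<^sub>M N"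
proof -
  have "(\<lambda>uv. case_nat uv y) \<in> pM \<rightarrow>\<^sub>M FM nu (Suc n)"
    using assms(2) by (intro measurable_case_nat_FM') simp_all
  from measurable_compose[OF this assms(1)] show ?thesis .
qed

text \<open>Cauchy-Schwarz in the head variable. Because \<open>nu\<close> has mass 1, the factor of
  \<open>h\<close> over time and jump reduces to its norm over time.\<close>

lemma minus_kernel_section_bound:
  assumes "h \<in> B0" "u \<in> borel_measurable (FM nu (Suc n))" "y \<in> space (FM nu n)"
  shows "(\<integral>\<^sup>+uv. ennreal \<bar>minus_kernel n h u y uv\<bar> \<partial>pM)\<^sup>2
    \<le> B0_norm2 h * (\<integral>\<^sup>+uv. indicator (Sset (Suc n)) (case_nat uv y) * ennreal ((u (case_nat uv y))\<^sup>2) \<partial>pM)"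
proof -
  have h [measurable]: "h \<in> borel_measurable borel" using assms by (auto simp: B0_def)
  have "(\<lambda>x. indicator (Sset (Suc n)) x * ennreal \<bar>u x\<bar>) \<in> borel_measurable (FM nu (Suc n))"
    using assms(2) by measurable
  then have m: "(\<lambda>uv. indicator (Sset (Suc n)) (case_nat uv y) * ennreal \<bar>u (case_nat uv y)\<bar>) \<in> borel_measurable pM"
    by (rule measurable_section[OF _ assms(3)])
  have "(\<integral>\<^sup>+uv. ennreal \<bar>minus_kernel n h u y uv\<bar> \<partial>pM)\<^sup>2
     = (\<integral>\<^sup>+uv. ennreal \<bar>h (fst uv)\<bar> * (indicator (Sset (Suc n)) (case_nat uv y) * ennreal \<bar>u (case_nat uv y)\<bar>) \<partial>pM)\<^sup>2"
    by (intro arg_cong[where f="\<lambda>x. x\<^sup>2"] nn_integral_cong) (auto simp: indicator_def abs_mult ennreal_mult)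
  also have "\<dots> \<le> (\<integral>\<^sup>+uv. (ennreal \<bar>h (fst uv)\<bar>)\<^sup>2 \<partial>pM) * (\<integral>\<^sup>+uv. (indicator (Sset (Suc n)) (case_nat uv y) * ennreal \<bar>u (case_nat uv y)\<bar>)\<^sup>2 \<partial>pM)"
    by (rule Cauchy_Schwarz_nn_integral[OF _ m]) simp
  also have "(\<integral>\<^sup>+uv. (ennreal \<bar>h (fst uv)\<bar>)\<^sup>2 \<partial>pM) = B0_norm2 h"
    unfolding B0_norm2_def by (subst nn_integral_pM_fst[symmetric]) (auto simp: ennreal_power)
  also have "(\<integral>\<^sup>+uv. (indicator (Sset (Suc n)) (case_nat uv y) * ennreal \<bar>u (case_nat uv y)\<bar>)\<^sup>2 \<partial>pM)
     = (\<integral>\<^sup>+uv. indicator (Sset (Suc n)) (case_nat uv y) * ennreal ((u (case_nat uv y))\<^sup>2) \<partial>pM)"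
    by (intro nn_integral_cong) (auto simp: indicator_def ennreal_power)
  finally show ?thesis .
qed

lemma comp_norm2_eq_sections:
  assumes [measurable]: "u \<in> borel_measurable (FM nu (Suc n))"
  shows "comp_norm2 (Suc n) u = (\<integral>\<^sup>+y. \<integral>\<^sup>+uv. indicator (Sset (Suc n)) (case_nat uv y) * ennreal ((u (case_nat uv y))\<^sup>2) \<partial>pM \<partial>FM nu n)"
  unfolding comp_norm2_def by (rule nn_integral_FM_Suc') measurable

lemma measurable_sections_norm:
  assumes [measurable]: "u \<in> borel_measurable (FM nu (Suc n))"
  shows "(\<lambda>y. \<integral>\<^sup>+uv. indicator (Sset (Suc n)) (case_nat uv y) * ennreal ((u (case_nat uv y))\<^sup>2) \<partial>pM) \<in> borel_measurable (FM nu n)"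
proof -
  have "(\<lambda>x. indicator (Sset (Suc n)) x * ennreal ((u x)\<^sup>2)) \<in> borel_measurable (FM nu (Suc n))"
    by measurable
  from measurable_compose[OF measurable_case_nat_swap this] show ?thesis
    by (intro pM.borel_measurable_nn_integral) (simp add: split_beta')
qed

text \<open>The Bochner integral in \<^const>\<open>a_minus\<close> is 0 on non-integrable sections, so additivity of the annihilation operator only holds almost everywhere.\<close>

lemma minus_kernel_integrable:
  assumes "h \<in> B0" "u \<in> L2S (Suc n)"
  shows "AE y in FM nu n. integrable pM (minus_kernel n h u y)"
proof -
  have h [measurable]: "h \<in> borel_measurable borel" using assms by (auto simp: B0_def)
  have u [measurable]: "u \<in> borel_measurable (FM nu (Suc n))" and fin: "comp_norm2 (Suc n) u < \<infinity>"
    using assms by (auto simp: L2S_def)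
  \<comment> \<open>The finite norm of \<open>u\<close> is the integral of its section norms, so
    almost every section norm is finite.\<close>
  have "AE y in FM nu n. (\<integral>\<^sup>+uv. indicator (Sset (Suc n)) (case_nat uv y) * ennreal ((u (case_nat uv y))\<^sup>2) \<partial>pM) \<noteq> \<infinity>"
    using fin unfolding comp_norm2_eq_sections[OF u]
    by (intro nn_integral_PInf_AE measurable_sections_norm[OF u]) auto
  moreover have "AE y in FM nu n. y \<in> space (FM nu n)" by (rule AE_space)
  ultimately show ?thesis
  proof eventually_elim
    case (elim y)
    have "(\<lambda>x. indicator (Sset (Suc n)) x * h (fst (x 0)) * u x) \<in> borel_measurable (FM nu (Suc n))"
      by measurable
    from measurable_section[OF this elim(2)]
    have m: "minus_kernel n h u y \<in> borel_measurable pM" by simp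
    have "(\<integral>\<^sup>+uv. ennreal \<bar>minus_kernel n h u y uv\<bar> \<partial>pM)\<^sup>2 < \<infinity>"
      using minus_kernel_section_bound[OF assms(1) u elim(2)] elim(1) B0_norm2_finite[OF assms(1)]
      by (auto simp: ennreal_mult_less_top top.not_eq_extremum elim!: le_less_trans)
    then have "(\<integral>\<^sup>+uv. ennreal (norm (minus_kernel n h u y uv)) \<partial>pM) < \<infinity>"
      by (auto simp: power2_eq_square ennreal_mult_less_top)
    with m show ?case by (intro integrableI_bounded)
  qed
qed

lemma a_minus_comp_norm2:
  assumes "h \<in> B0" "f (Suc n) \<in> borel_measurable (FM nu (Suc n))"
  shows "comp_norm2 n (a_minus nu h f n) \<le> B0_norm2 h * comp_norm2 (Suc n) (f (Suc n))"
proof -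
  have "comp_norm2 n (a_minus nu h f n) \<le> (\<integral>\<^sup>+y. B0_norm2 h * (\<integral>\<^sup>+uv. indicator (Sset (Suc n)) (case_nat uv y) * ennreal ((f (Suc n) (case_nat uv y))\<^sup>2) \<partial>pM) \<partial>FM nu n)"
    unfolding comp_norm2_def
  proof (rule nn_integral_mono)
    fix y assume y: "y \<in> space (FM nu n)"
    have "ennreal \<bar>a_minus nu h f n y\<bar> \<le> (\<integral>\<^sup>+uv. ennreal \<bar>minus_kernel n h (f (Suc n)) y uv\<bar> \<partial>pM)"
    proof (cases "integrable pM (minus_kernel n h (f (Suc n)) y)")
      case True
      from integral_norm_bound_ennreal[OF this] show ?thesis
        by (simp add: a_minus_def)
    next
      \<comment> \<open>Here the Bochner integral has its default value 0, so the estimate holds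
        without finiteness of the norm of \<open>f (Suc n)\<close>.\<close>
      case False
      then show ?thesis by (simp add: a_minus_def not_integrable_integral_eq)
    qed
    then have "(ennreal \<bar>a_minus nu h f n y\<bar>)\<^sup>2 \<le> (\<integral>\<^sup>+uv. ennreal \<bar>minus_kernel n h (f (Suc n)) y uv\<bar> \<partial>pM)\<^sup>2"
      by (intro power_mono) auto
    also note minus_kernel_section_bound[OF assms y]
    finally have "ennreal ((a_minus nu h f n y)\<^sup>2) \<le> B0_norm2 h * (\<integral>\<^sup>+uv. indicator (Sset (Suc n)) (case_nat uv y) * ennreal ((f (Suc n) (case_nat uv y))\<^sup>2) \<partial>pM)"
      by (simp add: ennreal_power)
    then show "indicator (Sset n) y * ennreal ((a_minus nu h f n y)\<^sup>2) \<le> B0_norm2 h * (\<integral>\<^sup>+uv. indicator (Sset (Suc n)) (case_nat uv y) * ennreal ((f (Suc n) (case_nat uv y))\<^sup>2) \<partial>pM)"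
      by (simp add: indicator_def)
  qed
  also have "\<dots> = B0_norm2 h * comp_norm2 (Suc n) (f (Suc n))"
    using measurable_sections_norm[OF assms(2)]
    by (simp add: nn_integral_cmult comp_norm2_eq_sections[OF assms(2)])
  finally show ?thesis .
qed

lemma a_minus_norm2:
  assumes "h \<in> B0" "\<And>m. f m \<in> borel_measurable (FM nu m)"
  shows "fock_norm2 (a_minus nu h f) \<le> B0_norm2 h * fock_norm2 f"
proof -
  have "fock_norm2 (a_minus nu h f) \<le> (\<Sum>n. B0_norm2 h * comp_norm2 (Suc n) (f (Suc n)))"
    unfolding fock_norm2_def using assms by (intro suminf_le a_minus_comp_norm2) auto
  also have "\<dots> = B0_norm2 h * (\<Sum>n. comp_norm2 (Suc n) (f (Suc n)))"
    by (rule ennreal_suminf_cmult)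
  also have "\<dots> \<le> B0_norm2 h * fock_norm2 f"
    unfolding fock_norm2_def
    by (intro mult_left_mono) (use suminf_offset[of "\<lambda>n. comp_norm2 n (f n)" 1] in auto)
  finally show ?thesis .
qed

text \<open>Almost everywhere the difference of the two annihilated vectors is the annihilated
  difference, to which the norm bound applies.\<close>

lemma a_minus_diff_norm2:
  assumes "h \<in> B0" "f \<in> fock nu" "g \<in> fock nu"
  shows "fock_norm2 (\<lambda>n x. a_minus nu h f n x - a_minus nu h g n x) \<le> B0_norm2 h * fock_dist2 nu f g"
proof -
  have "fock_norm2 (\<lambda>n x. a_minus nu h f n x - a_minus nu h g n x)
      \<le> fock_norm2 (a_minus nu h (\<lambda>n x. f n x - g n x))"
    unfolding fock_norm2_def
  proof (intro suminf_le comp_norm2_mono_AE)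
    fix n
    show "AE x in FM nu n. x \<in> Sset n \<longrightarrow> \<bar>a_minus nu h f n x - a_minus nu h g n x\<bar>
       \<le> \<bar>a_minus nu h (\<lambda>n x. f n x - g n x) n x\<bar>"
      using minus_kernel_integrable[OF assms(1) component_L2S[OF assms(2), of "Suc n"]]
        minus_kernel_integrable[OF assms(1) component_L2S[OF assms(3), of "Suc n"]]
    proof eventually_elim
      case (elim y)
      have "a_minus nu h (\<lambda>n x. f n x - g n x) n y = a_minus nu h f n y - a_minus nu h g n y"
        unfolding a_minus_def
        by (subst Bochner_Integration.integral_diff[OF elim, symmetric]) (simp add: algebra_simps)
      then show ?case by simp
    qed
  qed auto
  also have "\<dots> \<le> B0_norm2 h * fock_norm2 (\<lambda>n x. f n x - g n x)"
    using assms fock_measurable by (intro a_minus_norm2) auto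
  finally show ?thesis by (simp add: fock_dist2_eq)
qed

lemma a_plus_fock: "h \<in> B0 \<Longrightarrow> f \<in> fock nu \<Longrightarrow> a_plus h f \<in> fock nu"
  using a_plus_norm2[of h f] a_plus_measurable[of h f] B0_norm2_finite[of h]
  by (auto simp: fock_iff ennreal_mult_less_top elim!: le_less_trans)

lemma a_minus_fock: "h \<in> B0 \<Longrightarrow> f \<in> fock nu \<Longrightarrow> a_minus nu h f \<in> fock nu"
  using a_minus_norm2[of h f] a_minus_measurable[of h f] B0_norm2_finite[of h]
  by (auto simp: fock_iff ennreal_mult_less_top elim!: le_less_trans)

lemma a_zero_fock:
  assumes "h \<in> B0" "f \<in> fock nu"
  shows "a_zero h f \<in> fock nu"
proof -
  obtain B where "0 \<le> B" "\<And>t. \<bar>h t\<bar> \<le> B"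
    using B0_D[OF assms(1)] by metis
  then show ?thesis
    using a_zero_norm2[of h B f] a_zero_measurable[of h f] assms
    by (auto simp: fock_iff ennreal_mult_less_top elim!: le_less_trans)
qed

lemma omega_op_fock: "h \<in> B0 \<Longrightarrow> f \<in> fock nu \<Longrightarrow> omega_op nu h f \<in> fock nu"
  unfolding omega_op_def by (intro fock_add a_plus_fock a_zero_fock a_minus_fock)

lemma omega_op_bounded:
  assumes "h \<in> B0"
  obtains L where "L < \<infinity>"
    "\<And>f g. f \<in> fock nu \<Longrightarrow> g \<in> fock nu \<Longrightarrow> fock_dist2 nu (omega_op nu h f) (omega_op nu h g) \<le> L * fock_dist2 nu f g"
proof -
  obtain B where B: "0 \<le> B" "\<And>t. \<bar>h t\<bar> \<le> B"
    using B0_D[OF assms(1)] by metis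
  \<comment> \<open>Two nested uses of \<open>fock_norm2_add\<close> handle the three summands: the
    creation and neutral parts get the factor 4, the annihilation part the factor 2.\<close>
  define L where "L = 2 * (2 * B0_norm2 h + 2 * ennreal ((B * C)\<^sup>2)) + 2 * B0_norm2 h"
  have "fock_dist2 nu (omega_op nu h f) (omega_op nu h g) \<le> L * fock_dist2 nu f g"
    if f: "f \<in> fock nu" and g: "g \<in> fock nu" for f g
  proof -
    let ?d = "\<lambda>n x. f n x - g n x"
    let ?m = "\<lambda>n x. a_minus nu h f n x - a_minus nu h g n x"
    let ?p = "\<lambda>n x. a_plus h ?d n x + a_zero h ?d n x"
    have d: "?d \<in> fock nu" by (rule fock_diff[OF f g])
    have p: "?p \<in> fock nu" by (intro fock_add a_plus_fock a_zero_fock assms d)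
    have m: "?m \<in> fock nu" by (intro fock_diff a_minus_fock assms f g)
    \<comment> \<open>Creation and neutral operators are linear pointwise and may act on
      \<open>?d\<close>. The annihilation parts are linear only up to null sets and are kept apart
      as \<open>?m\<close>.\<close>
    have eq: "omega_op nu h f n x - omega_op nu h g n x = ?p n x + ?m n x" for n x
      by (cases n) (simp_all add: omega_op_def a_plus_def a_zero_def algebra_simps)
    have "fock_dist2 nu (omega_op nu h f) (omega_op nu h g) \<le> 2 * fock_norm2 ?p + 2 * fock_norm2 ?m"
      unfolding fock_dist2_eq eq by (rule fock_norm2_add[OF fock_measurable[OF p] fock_measurable[OF m]])
    also have "\<dots> \<le> 2 * (2 * fock_norm2 (a_plus h ?d) + 2 * fock_norm2 (a_zero h ?d)) + 2 * fock_norm2 ?m"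
      by (intro add_mono mult_left_mono fock_norm2_add fock_measurable a_plus_fock a_zero_fock assms d) auto
    also have "\<dots> \<le> 2 * (2 * (B0_norm2 h * fock_norm2 ?d) + 2 * (ennreal ((B * C)\<^sup>2) * fock_norm2 ?d)) + 2 * (B0_norm2 h * fock_norm2 ?d)"
      using a_minus_diff_norm2[OF assms f g, unfolded fock_dist2_eq]
      by (intro add_mono mult_left_mono a_plus_norm2 a_zero_norm2 assms B fock_measurable[OF d]) auto
    also have "\<dots> = L * fock_dist2 nu f g"
      by (simp add: L_def fock_dist2_eq algebra_simps)
    finally show ?thesis .
  qed
  moreover have "L < \<infinity>"
    using B0_norm2_finite[OF assms] by (simp add: L_def ennreal_mult_less_top)
  ultimately show thesis using that by blast
qed

lemma op_alg_fock: "P \<in> op_alg nu \<Longrightarrow> f \<in> fock nu \<Longrightarrow> P f \<in> fock nu"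
  by (induction arbitrary: f rule: op_alg.induct) (auto intro: omega_op_fock fock_add fock_scale)

section \<open>The closure of the vacuum orbit\<close>

text \<open>Cyclicity of the vacuum means that this set is all of \<open>fock nu\<close>.\<close>

definition vclosure :: "fvec set" where
  "vclosure = {f \<in> fock nu. \<forall>\<epsilon>>0. \<exists>P \<in> op_alg nu. fock_dist2 nu (P vacuum) f < ennreal \<epsilon>}"

lemma vclosure_fock: "f \<in> vclosure \<Longrightarrow> f \<in> fock nu"
  by (simp add: vclosure_def)

lemma vclosure_approx:
  assumes "f \<in> vclosure" "0 < \<epsilon>"
  obtains P where "P \<in> op_alg nu" "fock_dist2 nu (P vacuum) f < ennreal \<epsilon>"
proof -
  have "\<exists>P\<in>op_alg nu. fock_dist2 nu (P vacuum) f < ennreal \<epsilon>"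
    using assms by (simp add: vclosure_def)
  then show thesis by (elim bexE) (rule that)
qed

lemma fock_dist2_self [simp]: "fock_dist2 nu f f = 0"
  by (simp add: fock_dist2_eq fock_norm2_def)

lemma vacuum_vclosure: "vacuum \<in> vclosure"
  unfolding vclosure_def using vacuum_fock
  by (intro CollectI conjI allI impI bexI[where x="\<lambda>f. f"] op_alg.alg_id) simp_all

lemma vclosure_closed:
  assumes f: "f \<in> fock nu" and approx: "\<And>\<epsilon>. 0 < \<epsilon> \<Longrightarrow> \<exists>g\<in>vclosure. fock_dist2 nu g f \<le> ennreal \<epsilon>"
  shows "f \<in> vclosure"
  unfolding vclosure_def
proof (intro CollectI conjI f allI impI)
  fix \<epsilon> :: real assume "0 < \<epsilon>"
  \<comment> \<open>The triangle inequality for squared distances doubles both errors, so twice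
    \<epsilon>/8 yields \<epsilon>/2, strictly below \<epsilon> as \<open>vclosure\<close>
    demands.\<close>
  then obtain g where g: "g \<in> vclosure" "fock_dist2 nu g f \<le> ennreal (\<epsilon> / 8)"
    using approx[of "\<epsilon> / 8"] by auto
  then obtain P where P: "P \<in> op_alg nu" "fock_dist2 nu (P vacuum) g < ennreal (\<epsilon> / 8)"
    using \<open>0 < \<epsilon>\<close> vclosure_approx[of g "\<epsilon> / 8"] by auto
  have "fock_dist2 nu (P vacuum) f \<le> 2 * fock_dist2 nu (P vacuum) g + 2 * fock_dist2 nu g f"
    by (intro fock_dist2_triangle op_alg_fock[OF P(1) vacuum_fock] vclosure_fock g f)
  also have "\<dots> \<le> 2 * ennreal (\<epsilon> / 8) + 2 * ennreal (\<epsilon> / 8)"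
    using P g by (intro add_mono mult_left_mono) auto
  also have "\<dots> = ennreal (2 * (\<epsilon> / 8) + 2 * (\<epsilon> / 8))"
    using \<open>0 < \<epsilon>\<close> by (subst ennreal_plus) (auto simp: ennreal_double)
  also have "\<dots> < ennreal \<epsilon>"
    using \<open>0 < \<epsilon>\<close> by (simp add: ennreal_less_iff del: ennreal_plus)
  finally show "\<exists>P\<in>op_alg nu. fock_dist2 nu (P vacuum) f < ennreal \<epsilon>"
    using P by blast
qed

lemma op_alg_vclosure: "P \<in> op_alg nu \<Longrightarrow> P vacuum \<in> vclosure"
  unfolding vclosure_def using op_alg_fock[OF _ vacuum_fock, of P]
  by (intro CollectI conjI allI impI bexI[of _ P]) simp_all

lemma vclosure_add:
  assumes "f \<in> vclosure" "g \<in> vclosure"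
  shows "(\<lambda>n x. f n x + g n x) \<in> vclosure"
proof (rule vclosure_closed)
  show "(\<lambda>n x. f n x + g n x) \<in> fock nu"
    using assms by (intro fock_add vclosure_fock)
  fix \<epsilon> :: real assume "0 < \<epsilon>"
  then have "0 < \<epsilon> / 4" by simp
  then obtain P Q where P: "P \<in> op_alg nu" "fock_dist2 nu (P vacuum) f < ennreal (\<epsilon> / 4)"
    and Q: "Q \<in> op_alg nu" "fock_dist2 nu (Q vacuum) g < ennreal (\<epsilon> / 4)"
    by (metis vclosure_approx assms)
  let ?p = "\<lambda>n x. P vacuum n x - f n x" and ?q = "\<lambda>n x. Q vacuum n x - g n x"
  have "?p \<in> fock nu" "?q \<in> fock nu"
    by (intro fock_diff op_alg_fock[OF P(1) vacuum_fock] op_alg_fock[OF Q(1) vacuum_fock] vclosure_fock assms)+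
  then have "fock_norm2 (\<lambda>n x. ?p n x + ?q n x) \<le> 2 * fock_norm2 ?p + 2 * fock_norm2 ?q"
    by (intro fock_norm2_add fock_measurable)
  also have "\<dots> \<le> 2 * ennreal (\<epsilon> / 4) + 2 * ennreal (\<epsilon> / 4)"
    using P Q unfolding fock_dist2_eq by (intro add_mono mult_left_mono) auto
  also have "\<dots> = ennreal (2 * (\<epsilon> / 4) + 2 * (\<epsilon> / 4))"
    using \<open>0 < \<epsilon>\<close> by (subst ennreal_plus) (auto simp: ennreal_double)
  finally have "fock_dist2 nu (\<lambda>n x. P vacuum n x + Q vacuum n x) (\<lambda>n x. f n x + g n x) \<le> ennreal \<epsilon>"
    by (simp add: fock_dist2_eq algebra_simps)
  then show "\<exists>k\<in>vclosure. fock_dist2 nu k (\<lambda>n x. f n x + g n x) \<le> ennreal \<epsilon>"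
    using op_alg_vclosure[OF op_alg.alg_add[OF P(1) Q(1)]] by blast
qed

text \<open>The algebra is closed under composition, so \<open>Q (P vacuum)\<close> stays in the
  orbit, and the Lipschitz bound brings it close to \<open>Q f\<close>. A bound on differences is
  the suitable form of boundedness here, since representatives obey linearity only almost
  everywhere.\<close>

lemma vclosure_lipschitz:
  assumes f: "f \<in> vclosure" and Q: "Q \<in> op_alg nu" and L: "L < \<infinity>"
    and lip: "\<And>f g. f \<in> fock nu \<Longrightarrow> g \<in> fock nu \<Longrightarrow> fock_dist2 nu (Q f) (Q g) \<le> L * fock_dist2 nu f g"
  shows "Q f \<in> vclosure"
proof (rule vclosure_closed)
  show "Q f \<in> fock nu"
    using f by (intro op_alg_fock[OF Q] vclosure_fock)
  fix \<epsilon> :: real assume "0 < \<epsilon>"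
  then obtain d where d: "0 < d" "L * ennreal d \<le> ennreal \<epsilon>"
    using ennreal_mult_small[OF L] by blast
  then obtain P where P: "P \<in> op_alg nu" "fock_dist2 nu (P vacuum) f < ennreal d"
    using vclosure_approx[OF f] by blast
  have "fock_dist2 nu (Q (P vacuum)) (Q f) \<le> L * fock_dist2 nu (P vacuum) f"
    by (intro lip op_alg_fock[OF P(1) vacuum_fock] vclosure_fock f)
  also have "\<dots> \<le> L * ennreal d"
    using P by (intro mult_left_mono) auto
  finally have "fock_dist2 nu (Q (P vacuum)) (Q f) \<le> ennreal \<epsilon>"
    using d by simp
  then show "\<exists>k\<in>vclosure. fock_dist2 nu k (Q f) \<le> ennreal \<epsilon>"
    using op_alg_vclosure[OF op_alg.alg_comp[OF Q P(1)]] by blast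
qed

lemma vclosure_scale:
  assumes "f \<in> vclosure" shows "(\<lambda>n x. c * f n x) \<in> vclosure"
proof (rule vclosure_lipschitz[OF assms op_alg.alg_smult[OF op_alg.alg_id], of "ennreal (c\<^sup>2)"])
  fix f g assume "f \<in> fock nu" "g \<in> fock nu"
  then have "fock_norm2 (\<lambda>n x. c * (f n x - g n x)) = ennreal (c\<^sup>2) * fock_norm2 (\<lambda>n x. f n x - g n x)"
    by (intro fock_norm2_scale fock_measurable fock_diff)
  then show "fock_dist2 nu (\<lambda>n x. c * f n x) (\<lambda>n x. c * g n x) \<le> ennreal (c\<^sup>2) * fock_dist2 nu f g"
    by (simp add: fock_dist2_eq algebra_simps)
qed simp

lemma vclosure_diff: "f \<in> vclosure \<Longrightarrow> g \<in> vclosure \<Longrightarrow> (\<lambda>n x. f n x - g n x) \<in> vclosure"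
  using vclosure_add[OF _ vclosure_scale[of g "-1"]] by simp

lemma vclosure_omega_op:
  assumes "h \<in> B0" "f \<in> vclosure" shows "omega_op nu h f \<in> vclosure"
proof -
  obtain L where "L < \<infinity>" "\<And>f g. f \<in> fock nu \<Longrightarrow> g \<in> fock nu \<Longrightarrow>
      fock_dist2 nu (omega_op nu h f) (omega_op nu h g) \<le> L * fock_dist2 nu f g"
    using omega_op_bounded[OF assms(1)] by blast
  then show ?thesis
    by (rule vclosure_lipschitz[OF assms(2) op_alg.alg_gen[OF assms(1)]])
qed

lemma vclosure_zero: "(\<lambda>n x. 0) \<in> vclosure"
  using vclosure_scale[OF vacuum_vclosure, of 0] by simp

lemma vclosure_sum:
  assumes "finite I" "\<And>i. i \<in> I \<Longrightarrow> f i \<in> vclosure"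
  shows "(\<lambda>n x. \<Sum>i\<in>I. f i n x) \<in> vclosure"
  using assms by (induction I) (auto intro: vclosure_zero vclosure_add)

section \<open>The n-particle functions in the closure, to be shown to exhaust
  \<open>L2S n\<close>\<close>

definition W :: "nat \<Rightarrow> (fpoint \<Rightarrow> real) set" where
  "W n = {u. emb n u \<in> vclosure}"

lemma W_L2S: "u \<in> W n \<Longrightarrow> u \<in> L2S n"
  unfolding W_def by (auto dest: vclosure_fock)

lemma W_measurable: "u \<in> W n \<Longrightarrow> u \<in> borel_measurable (FM nu n)"
  by (intro L2S_measurable W_L2S)

lemma W_add: "u \<in> W n \<Longrightarrow> v \<in> W n \<Longrightarrow> (\<lambda>x. u x + v x) \<in> W n"
proof -
  have "(\<lambda>m x. emb n u m x + emb n v m x) = emb n (\<lambda>x. u x + v x)"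
    by (auto simp: emb_def fun_eq_iff)
  then show "u \<in> W n \<Longrightarrow> v \<in> W n \<Longrightarrow> (\<lambda>x. u x + v x) \<in> W n"
    using vclosure_add[of "emb n u" "emb n v"] by (simp add: W_def)
qed

lemma W_scale: "u \<in> W n \<Longrightarrow> (\<lambda>x. c * u x) \<in> W n"
proof -
  have "(\<lambda>m x. c * emb n u m x) = emb n (\<lambda>x. c * u x)"
    by (auto simp: emb_def fun_eq_iff)
  then show "u \<in> W n \<Longrightarrow> (\<lambda>x. c * u x) \<in> W n"
    using vclosure_scale[of "emb n u" c] by (simp add: W_def)
qed

lemma W_diff: "u \<in> W n \<Longrightarrow> v \<in> W n \<Longrightarrow> (\<lambda>x. u x - v x) \<in> W n"
  using W_add[OF _ W_scale[of v n "-1"]] by simp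

lemma W_zero: "(\<lambda>x. 0) \<in> W n"
  using vclosure_zero by (simp add: W_def emb_def)

lemma W_sum: "finite I \<Longrightarrow> (\<And>i. i \<in> I \<Longrightarrow> u i \<in> W n) \<Longrightarrow> (\<lambda>x. \<Sum>i\<in>I. u i x) \<in> W n"
  by (induction I rule: finite_induct) (auto intro: W_zero W_add)

lemma W_closed:
  assumes "u \<in> L2S n" "\<And>\<epsilon>. 0 < \<epsilon> \<Longrightarrow> \<exists>v\<in>W n. comp_norm2 n (\<lambda>x. v x - u x) \<le> ennreal \<epsilon>"
  shows "u \<in> W n"
  unfolding W_def mem_Collect_eq
proof (rule vclosure_closed)
  show "emb n u \<in> fock nu" using assms(1) by simp
  fix \<epsilon> :: real assume "0 < \<epsilon>"
  with assms(2) obtain v where "v \<in> W n" "comp_norm2 n (\<lambda>x. v x - u x) \<le> ennreal \<epsilon>" by blast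
  then show "\<exists>g\<in>vclosure. fock_dist2 nu g (emb n u) \<le> ennreal \<epsilon>"
    by (auto simp: W_def fock_dist2_emb intro!: bexI[of _ "emb n v"])
qed

lemma L2S_mono_AE:
  assumes "v \<in> L2S n" "u \<in> borel_measurable (FM nu n)" "AE x in FM nu n. x \<in> Sset n \<longrightarrow> \<bar>u x\<bar> \<le> \<bar>v x\<bar>"
  shows "u \<in> L2S n"
  using comp_norm2_mono_AE[OF assms(3)] assms(1,2) by (auto simp: L2S_def)

lemma L2S_scale: "u \<in> L2S n \<Longrightarrow> (\<lambda>x. c * u x) \<in> L2S n"
  by (auto simp: L2S_def comp_norm2_scale ennreal_mult_less_top intro!: borel_measurable_times)

text \<open>Dominated convergence turns almost sure limits on \<open>Sset n\<close> into limits in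
  norm. The limits of polynomials, of disjoint unions and of simple functions are all taken this
  way.\<close>

lemma W_dominated:
  assumes u: "\<And>i. u i \<in> W n" and v [measurable]: "v \<in> borel_measurable (FM nu n)" and w: "w \<in> L2S n"
    and bound: "\<And>i. AE x in FM nu n. x \<in> Sset n \<longrightarrow> \<bar>u i x\<bar> \<le> w x"
    and lim: "AE x in FM nu n. x \<in> Sset n \<longrightarrow> (\<lambda>i. u i x) \<longlonglongrightarrow> v x"
  shows "v \<in> W n"
proof -
  have [measurable]: "u i \<in> borel_measurable (FM nu n)" for i
    using u by (rule W_measurable)
  have [measurable]: "w \<in> borel_measurable (FM nu n)"
    using w by (rule L2S_measurable)
  have vb: "AE x in FM nu n. x \<in> Sset n \<longrightarrow> \<bar>v x\<bar> \<le> w x"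
  proof -
    have "AE x in FM nu n. \<forall>i. x \<in> Sset n \<longrightarrow> \<bar>u i x\<bar> \<le> w x"
      unfolding AE_all_countable using bound by blast
    with lim show ?thesis
    proof eventually_elim
      case (elim x)
      show ?case
      proof
        assume "x \<in> Sset n"
        with elim have "(\<lambda>i. \<bar>u i x\<bar>) \<longlonglongrightarrow> \<bar>v x\<bar>" "\<And>i. \<bar>u i x\<bar> \<le> w x"
          by (auto intro: tendsto_rabs)
        then show "\<bar>v x\<bar> \<le> w x"
          by (intro LIMSEQ_le_const2[of _ "\<bar>v x\<bar>"]) auto
      qed
    qed
  qed
  have vL: "v \<in> L2S n"
    using vb by (intro L2S_mono_AE[OF w v]) (auto elim!: eventually_mono)
  have "(\<lambda>i. comp_norm2 n (\<lambda>x. u i x - v x)) \<longlonglongrightarrow> (\<integral>\<^sup>+x. 0 \<partial>FM nu n)"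
    unfolding comp_norm2_def
  proof (rule nn_integral_dominated_convergence)
    \<comment> \<open>Both \<open>u i\<close> and its limit are bounded by \<open>w\<close>, hence
      their difference by \<open>2 * w\<close>.\<close>
    show "AE x in FM nu n. indicator (Sset n) x * ennreal ((u i x - v x)\<^sup>2) \<le> indicator (Sset n) x * ennreal ((2 * w x)\<^sup>2)" for i
      using bound[of i] vb
    proof eventually_elim
      case (elim x)
      show ?case
      proof (cases "x \<in> Sset n")
        case True
        with elim have "\<bar>u i x - v x\<bar> \<le> \<bar>2 * w x\<bar>" by auto
        then have "(u i x - v x)\<^sup>2 \<le> (2 * w x)\<^sup>2" by (simp only: abs_le_square_iff)
        then show ?thesis by (intro mult_left_mono ennreal_leI) auto
      qed simp
    qed
    show "(\<integral>\<^sup>+x. indicator (Sset n) x * ennreal ((2 * w x)\<^sup>2) \<partial>FM nu n) < \<infinity>"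
      using L2S_scale[OF w, of 2] by (simp add: L2S_def comp_norm2_def)
    show "AE x in FM nu n. (\<lambda>i. indicator (Sset n) x * ennreal ((u i x - v x)\<^sup>2)) \<longlonglongrightarrow> 0"
      using lim
    proof eventually_elim
      case (elim x)
      show ?case
      proof (cases "x \<in> Sset n")
        case True
        with elim have "(\<lambda>i. (u i x - v x)\<^sup>2) \<longlonglongrightarrow> (v x - v x)\<^sup>2"
          by (intro tendsto_intros) auto
        then have "(\<lambda>i. ennreal ((u i x - v x)\<^sup>2)) \<longlonglongrightarrow> ennreal ((v x - v x)\<^sup>2)"
          by (rule tendsto_ennrealI)
        with True show ?thesis by simp
      qed simp
    qed
  qed auto
  then have lim0: "(\<lambda>i. comp_norm2 n (\<lambda>x. u i x - v x)) \<longlonglongrightarrow> 0" by simp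
  show ?thesis
  proof (rule W_closed[OF vL])
    fix \<epsilon> :: real assume "0 < \<epsilon>"
    then have "eventually (\<lambda>i. comp_norm2 n (\<lambda>x. u i x - v x) < ennreal \<epsilon>) sequentially"
      by (intro order_tendstoD(2)[OF lim0]) simp
    then obtain i where "comp_norm2 n (\<lambda>x. u i x - v x) < ennreal \<epsilon>"
      by (auto simp: eventually_sequentially)
    then show "\<exists>w\<in>W n. comp_norm2 n (\<lambda>x. w x - v x) \<le> ennreal \<epsilon>"
      using u by (intro bexI[of _ "u i"]) auto
  qed
qed

text \<open>This is \<open>W_dominated\<close> for the constant sequence \<open>u\<close>, with the
  absolute value of \<open>u\<close> as the bound.\<close>

lemma W_cong_AE:
  assumes u: "u \<in> W n" and v: "v \<in> borel_measurable (FM nu n)"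
    and eq: "AE x in FM nu n. x \<in> Sset n \<longrightarrow> u x = v x"
  shows "v \<in> W n"
proof (rule W_dominated[OF u v, of "\<lambda>x. \<bar>u x\<bar>"])
  show "(\<lambda>x. \<bar>u x\<bar>) \<in> L2S n"
    using W_measurable[OF u] by (intro L2S_mono_AE[OF W_L2S[OF u]]) auto
qed (use eq in \<open>auto elim!: eventually_mono\<close>)

lemma W_cong:
  assumes "u \<in> W n" "v \<in> borel_measurable (FM nu n)"
    and "\<And>x. x \<in> space (FM nu n) \<Longrightarrow> x \<in> Sset n \<Longrightarrow> u x = v x"
  shows "v \<in> W n"
  using assms(3) by (intro W_cong_AE[OF assms(1,2)] AE_I2) auto

text \<open>\<open>FM nu 0\<close> lives on a single point, so every function of 0 particles agrees
  there with a multiple of the vacuum component.\<close>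

lemma W_0: "L2S 0 \<subseteq> W 0"
proof
  fix u assume u: "u \<in> L2S 0"
  have "(\<lambda>x. 1) \<in> W 0"
    using vacuum_vclosure by (simp add: W_def vacuum_eq)
  from W_scale[OF this, of "u (\<lambda>_. undefined)"] have "(\<lambda>x. u (\<lambda>_. undefined)) \<in> W 0"
    by simp
  then show "u \<in> W 0"
    by (rule W_cong[OF _ L2S_measurable[OF u]]) (simp add: space_FM)
qed

section \<open>Separating creation, neutral and annihilation parts\<close>

lemma lower_components_vclosure:
  assumes F: "F \<in> fock nu" and low: "\<And>j. j < n \<Longrightarrow> L2S j \<subseteq> W j" and zero: "\<And>m x. n \<le> m \<Longrightarrow> F m x = 0"
  shows "F \<in> vclosure"
proof -
  have "(\<lambda>m x. \<Sum>j<n. emb j (F j) m x) \<in> vclosure"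
    using low component_L2S[OF F] by (intro vclosure_sum) (auto simp: W_def)
  also have "(\<lambda>m x. \<Sum>j<n. emb j (F j) m x) = F"
    using zero by (auto simp: emb_def fun_eq_iff sum.delta)
  finally show ?thesis .
qed

text \<open>The annihilation part has fewer than \<open>n\<close> particles and can be subtracted.
  The neutral part keeps \<open>n\<close> particles and remains in the sum: in the passage from s^k
  to s^(k+1) only \<open>v\<close> itself is known to lie in \<open>W n\<close>, not yet all of
  \<open>L2S n\<close>.\<close>

lemma plus_zero_vclosure:
  assumes v: "v \<in> W n" and low: "\<And>j. j < n \<Longrightarrow> L2S j \<subseteq> W j" and h: "h \<in> B0"
  shows "(\<lambda>m x. a_plus h (emb n v) m x + a_zero h (emb n v) m x) \<in> vclosure"
proof -
  have e: "emb n v \<in> vclosure" using v by (simp add: W_def)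
  have "a_minus nu h (emb n v) \<in> vclosure"
    by (rule lower_components_vclosure[OF a_minus_fock[OF h vclosure_fock[OF e]] low]) (auto simp: a_minus_def emb_def)
  from vclosure_diff[OF vclosure_omega_op[OF h e] this] show ?thesis
    by (simp add: omega_op_def)
qed

lemma a_plus_emb: "a_plus h (emb n f) = emb (Suc n) (tens (\<lambda>uv. h (fst uv)) f)"
  by (auto simp: a_plus_def emb_def tens_def fun_eq_iff split: nat.split)

text \<open>Now \<open>low\<close> includes \<open>n\<close> itself, so the neutral part can be
  subtracted as well and only creation is left.\<close>

lemma tens_B0_W:
  assumes f: "f \<in> L2S n" and low: "\<And>j. j \<le> n \<Longrightarrow> L2S j \<subseteq> W j" and h: "h \<in> B0"
  shows "tens (\<lambda>uv. h (fst uv)) f \<in> W (Suc n)"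
proof -
  have f': "emb n f \<in> fock nu" "f \<in> W n" using f low by auto
  have "a_zero h (emb n f) \<in> vclosure"
    by (rule lower_components_vclosure[OF a_zero_fock[OF h f'(1)], of "Suc n"])
       (use low in \<open>auto simp: a_zero_def emb_def\<close>)
  from vclosure_diff[OF plus_zero_vclosure[OF f'(2) _ h] this] low
  show ?thesis by (simp add: W_def a_plus_emb)
qed

section \<open>Products with powers of the jump variable\<close>

text \<open>For a fixed first time the second time is confined to an interval of length 2 \<delta>,
  and the power of its jump is at most \<open>C ^ k\<close> almost surely. Integrating over the
  first particle adds the factor \<open>B0_norm2 h\<close>.\<close>

lemma near_diagonal_norm:
  assumes h: "h \<in> B0" and f: "f \<in> borel_measurable (FM nu n)" and "0 \<le> \<delta>"
  shows "comp_norm2 (Suc (Suc n)) (\<lambda>x. h (fst (x 0)) * tens (\<lambda>uv. (if \<bar>fst uv - fst (x 0)\<bar> \<le> \<delta> then 1 else 0) * snd uv ^ k) f (x \<circ> Suc))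
    \<le> B0_norm2 h * (ennreal (2 * \<delta> * (C ^ k)\<^sup>2) * comp_norm2 n f)"
proof -
  have [measurable]: "h \<in> borel_measurable borel" using h by (auto simp: B0_def)
  let ?G = "\<lambda>a uv. (if \<bar>fst uv - a\<bar> \<le> \<delta> then 1 else 0) * snd uv ^ k :: real"
  have Gm [measurable]: "?G a \<in> borel_measurable borel" for a
    by measurable
  have G: "(\<integral>\<^sup>+uv. ennreal ((?G a uv)\<^sup>2) \<partial>pM) \<le> ennreal (2 * \<delta> * (C ^ k)\<^sup>2)" for a
  proof -
    have "(\<integral>\<^sup>+uv. ennreal ((?G a uv)\<^sup>2) \<partial>pM) = (\<integral>\<^sup>+uv. indicator {a - \<delta>..a + \<delta>} (fst uv) * ennreal ((snd uv ^ k)\<^sup>2) \<partial>pM)"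
      by (intro nn_integral_cong) (auto simp: indicator_def abs_le_iff)
    also have "\<dots> = (\<integral>\<^sup>+t. indicator {a - \<delta>..a + \<delta>} t \<partial>lborel) * (\<integral>\<^sup>+s. ennreal ((s ^ k)\<^sup>2) \<partial>nu)"
      by (rule nn_integral_pM_mult) auto
    also have "\<dots> \<le> ennreal (2 * \<delta>) * (\<integral>\<^sup>+s. ennreal ((C ^ k)\<^sup>2) \<partial>nu)"
    proof (intro mult_mono nn_integral_mono_AE)
      show "AE s in nu. ennreal ((s ^ k)\<^sup>2) \<le> ennreal ((C ^ k)\<^sup>2)"
        using support
      proof eventually_elim
        case (elim s)
        then have "\<bar>s ^ k\<bar> \<le> \<bar>C ^ k\<bar>" using C_nonneg by (simp add: power_abs power_mono)
        then show ?case by (intro ennreal_leI) (simp add: abs_le_square_iff)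
      qed
    qed (use \<open>0 \<le> \<delta>\<close> in auto)
    also have "\<dots> = ennreal (2 * \<delta> * (C ^ k)\<^sup>2)"
      using \<open>0 \<le> \<delta>\<close> by (simp add: emeasure_space_1[simplified] ennreal_mult)
    finally show ?thesis .
  qed
  have "(\<lambda>x. h (fst (x 0)) * tens (?G (fst (x 0))) f (x \<circ> Suc)) \<in> borel_measurable (FM nu (Suc (Suc n)))"
  proof -
    have [measurable]: "(\<lambda>x. fst (x (Suc 0))) \<in> borel_measurable (FM nu (Suc (Suc n)))"
      "(\<lambda>x. snd (x (Suc 0))) \<in> borel_measurable (FM nu (Suc (Suc n)))"
      by (rule measurable_compose[OF measurable_component_FM borel_measurable_fst_snd(1)], simp,
          rule measurable_compose[OF measurable_component_FM borel_measurable_fst_snd(2)], simp)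
    have [measurable]: "(\<lambda>x. f ((x \<circ> Suc) \<circ> Suc)) \<in> borel_measurable (FM nu (Suc (Suc n)))"
      by (rule measurable_compose[OF measurable_tail_FM measurable_compose[OF measurable_tail_FM f]])
    show ?thesis unfolding tens_def by simp
  qed
  then have "comp_norm2 (Suc (Suc n)) (\<lambda>x. h (fst (x 0)) * tens (?G (fst (x 0))) f (x \<circ> Suc))
      \<le> (\<integral>\<^sup>+uv. comp_norm2 (Suc n) (\<lambda>y. h (fst uv) * tens (?G (fst uv)) f y) \<partial>pM)"
    by (rule comp_norm2_section[where F="\<lambda>uv y. h (fst uv) * tens (?G (fst uv)) f y"])
  also have "\<dots> \<le> (\<integral>\<^sup>+uv. ennreal ((h (fst uv))\<^sup>2) * (ennreal (2 * \<delta> * (C ^ k)\<^sup>2) * comp_norm2 n f) \<partial>pM)"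
  proof (rule nn_integral_mono)
    fix uv :: "real \<times> real"
    have "comp_norm2 (Suc n) (\<lambda>y. h (fst uv) * tens (?G (fst uv)) f y) = ennreal ((h (fst uv))\<^sup>2) * comp_norm2 (Suc n) (tens (?G (fst uv)) f)"
      by (rule comp_norm2_scale[OF measurable_tens[OF Gm f]])
    also have "\<dots> \<le> ennreal ((h (fst uv))\<^sup>2) * (ennreal (2 * \<delta> * (C ^ k)\<^sup>2) * comp_norm2 n f)"
      by (intro mult_left_mono order_trans[OF comp_norm2_tens[OF Gm f]] mult_right_mono G) auto
    finally show "comp_norm2 (Suc n) (\<lambda>y. h (fst uv) * tens (?G (fst uv)) f y) \<le> ennreal ((h (fst uv))\<^sup>2) * (ennreal (2 * \<delta> * (C ^ k)\<^sup>2) * comp_norm2 n f)" .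
  qed
  also have "\<dots> = (\<integral>\<^sup>+uv. ennreal ((h (fst uv))\<^sup>2) \<partial>pM) * (ennreal (2 * \<delta> * (C ^ k)\<^sup>2) * comp_norm2 n f)"
    by (rule nn_integral_multc) simp
  also have "(\<integral>\<^sup>+uv. ennreal ((h (fst uv))\<^sup>2) \<partial>pM) = B0_norm2 h"
    unfolding B0_norm2_def by (rule nn_integral_pM_fst) simp
  finally show ?thesis .
qed

lemma tens_power_Suc_W:
  assumes low: "\<And>j. j \<le> n \<Longrightarrow> L2S j \<subseteq> W j"
    and IH: "\<And>h f. h \<in> B0 \<Longrightarrow> f \<in> L2S n \<Longrightarrow> tens (\<lambda>uv. h (fst uv) * snd uv ^ k) f \<in> W (Suc n)"
    and h: "h \<in> B0" and f: "f \<in> L2S n"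
  shows "tens (\<lambda>uv. h (fst uv) * snd uv ^ Suc k) f \<in> W (Suc n)"
proof -
  obtain K0 where hm [measurable]: "h \<in> borel_measurable borel" and K0: "\<And>t. t \<notin> {0..K0} \<Longrightarrow> h t = 0"
    using B0_D[OF h] by metis
  have fm [measurable]: "f \<in> borel_measurable (FM nu n)" by (rule L2S_measurable[OF f])
  \<comment> \<open>With an integer \<open>K\<close> the cells of index below \<open>N * K\<close>
    fill exactly [0, K), and \<open>h\<close> vanishes outside that interval.\<close>
  obtain K :: nat where "K0 < real K" using reals_Archimedean2 by blast
  with K0 have K: "t \<notin> {0..<real K} \<Longrightarrow> h t = 0" for t by auto
  let ?u = "tens (\<lambda>uv. h (fst uv) * snd uv ^ Suc k) f"
  have u: "?u \<in> L2S (Suc n)"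
  proof (rule L2S_mono_AE[OF L2S_scale[OF W_L2S[OF IH[OF h f]], of C]])
    show "AE x in FM nu (Suc n). x \<in> Sset (Suc n) \<longrightarrow> \<bar>?u x\<bar> \<le> \<bar>C * tens (\<lambda>uv. h (fst uv) * snd uv ^ k) f x\<bar>"
      using AE_FM_head[of n]
    proof eventually_elim
      case (elim x)
      have "\<bar>snd (x 0)\<bar> * \<bar>h (fst (x 0)) * snd (x 0) ^ k * f (x \<circ> Suc)\<bar> \<le> \<bar>C\<bar> * \<bar>h (fst (x 0)) * snd (x 0) ^ k * f (x \<circ> Suc)\<bar>"
        using elim C_nonneg by (intro mult_right_mono) auto
      then show ?case by (simp add: tens_def abs_mult ac_simps)
    qed
  qed (intro measurable_tens fm, measurable)
  show ?thesis
    unfolding W_def mem_Collect_eq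
  proof (rule vclosure_closed)
    show "emb (Suc n) ?u \<in> fock nu" using u by simp
    fix \<epsilon> :: real assume "0 < \<epsilon>"
    \<comment> \<open>By \<open>near_diagonal_norm\<close> with width 1/N the squared error will be
      at most \<open>L\<close> times 1/N.\<close>
    define L where "L = B0_norm2 h * (ennreal (2 * (C ^ k)\<^sup>2) * comp_norm2 n f)"
    have "L < \<infinity>"
      using B0_norm2_finite[OF h] f by (simp add: L_def L2S_def ennreal_mult_less_top)
    then obtain d where d: "0 < d" "L * ennreal d \<le> ennreal \<epsilon>"
      using ennreal_mult_small \<open>0 < \<epsilon>\<close> by blast
    obtain N :: nat where N: "0 < N" "1 / real N < d"
      using d(1) by (metis nat_approx_posE zero_less_Suc)
    let ?h = "\<lambda>j t. h t * indicator (cell N j) t"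
    \<comment> \<open>The cell in \<open>?v j\<close> matches the one in \<open>?h j\<close>. The
      cutoff to [0, K] brings the time factor into the form of \<open>B0_mult_indicator\<close> and
      equals 1 wherever \<open>h\<close> is nonzero.\<close>
    let ?v = "\<lambda>j. tens (\<lambda>uv. (indicator {0..real K} (fst uv) * indicator (cell N j) (fst uv)) * snd uv ^ k) f"
    let ?E = "\<lambda>m x. \<Sum>j<N * K. a_plus (?h j) (emb (Suc n) (?v j)) m x + a_zero (?h j) (emb (Suc n) (?v j)) m x"
    let ?e = "\<lambda>x. \<Sum>j<N * K. tens (\<lambda>uv. ?h j (fst uv)) (?v j) x"
    let ?e' = "\<lambda>x. h (fst (x 0)) * tens (\<lambda>uv. (if \<bar>fst uv - fst (x 0)\<bar> \<le> 1 / real N then 1 else 0) * snd uv ^ k) f (x \<circ> Suc)"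
    have cells: "cell N j \<in> sets borel" for j by (simp add: cell_def)
    have v: "?v j \<in> W (Suc n)" for j
      by (rule IH[OF B0_mult_indicator[OF indicator_B0 cells] f])
    have "?E \<in> vclosure"
    proof (rule vclosure_sum)
      fix j
      show "(\<lambda>m x. a_plus (?h j) (emb (Suc n) (?v j)) m x + a_zero (?h j) (emb (Suc n) (?v j)) m x) \<in> vclosure"
        using low by (intro plus_zero_vclosure[OF v _ B0_mult_indicator[OF h cells]]) simp
    qed simp
    moreover have "fock_dist2 nu ?E (emb (Suc n) ?u) \<le> ennreal \<epsilon>"
    proof -
      have hs: "h t * (\<Sum>j<N * K. indicator (cell N j) t) = h t" for t
        using cell_sum_self[OF N(1), of t K] K[of t] by (cases "t \<in> {0..<real K}") auto
      have hc: "h t * indicator (cell N j) t * (indicator {0..real K} t * indicator (cell N j) t) = h t * indicator (cell N j) t" for j t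
        using K[of t] by (cases "t \<in> {0..<real K}") (auto simp: indicator_def)
      have az: "?h j (fst (x 0)) * snd (x 0) * ?v j x = h (fst (x 0)) * indicator (cell N j) (fst (x 0)) * (snd (x 0) ^ Suc k * f (x \<circ> Suc))" for j x
      proof -
        have "?h j (fst (x 0)) * snd (x 0) * ?v j x
          = (h (fst (x 0)) * indicator (cell N j) (fst (x 0)) * (indicator {0..real K} (fst (x 0)) * indicator (cell N j) (fst (x 0)))) * (snd (x 0) ^ Suc k * f (x \<circ> Suc))"
          by (simp only: tens_def power_Suc ac_simps)
        then show ?thesis by (simp only: hc)
      qed
      \<comment> \<open>A neutral term carries its cell indicator twice, which is the same as once,
        and the cells add up to 1 wherever \<open>h\<close> is nonzero.\<close>
      have "(\<Sum>j<N * K. ?h j (fst (x 0)) * snd (x 0) * ?v j x) = ?u x" for x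
        unfolding az sum_distrib_right[symmetric] sum_distrib_left[symmetric] hs by (simp add: tens_def)
      \<comment> \<open>The neutral parts cancel the target, so the error consists of creation terms
        with \<open>n + 2\<close> particles.\<close>
      then have "?E m x - emb (Suc n) ?u m x = emb (Suc (Suc n)) ?e m x" for m x
        unfolding a_plus_emb by (auto simp: emb_def a_zero_def sum.distrib intro!: sum.neutral)
      then have "fock_dist2 nu ?E (emb (Suc n) ?u) = comp_norm2 (Suc (Suc n)) ?e"
        unfolding fock_dist2_eq emb_norm2[symmetric] by simp
      also have "\<dots> \<le> comp_norm2 (Suc (Suc n)) ?e'"
      proof (intro comp_norm2_mono_AE AE_I2 impI)
        fix x :: fpoint
        let ?a = "fst (x 0)" and ?b = "fst (x (Suc 0))"
        \<comment> \<open>In each summand the created particle and the former head must share a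
          cell, so \<open>cell_sum_pair\<close> bounds the collected sum.\<close>
        have "?e x = h ?a * (indicator {0..real K} ?b * snd (x (Suc 0)) ^ k * f (x \<circ> Suc \<circ> Suc)) * (\<Sum>j<N * K. indicator (cell N j) ?a * indicator (cell N j) ?b)"
          unfolding sum_distrib_left by (simp add: tens_def ac_simps)
        also have "\<bar>\<dots>\<bar> \<le> \<bar>h ?a * (1 * snd (x (Suc 0)) ^ k * f (x \<circ> Suc \<circ> Suc))\<bar> * (if \<bar>?b - ?a\<bar> \<le> 1 / real N then 1 else 0)"
          unfolding abs_mult by (intro mult_mono cell_sum_pair N) (auto simp: indicator_def)
        also have "\<dots> = \<bar>?e' x\<bar>"
          by (simp add: tens_def)
        finally show "\<bar>?e x\<bar> \<le> \<bar>?e' x\<bar>" .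
      qed
      also have "\<dots> \<le> B0_norm2 h * (ennreal (2 * (1 / real N) * (C ^ k)\<^sup>2) * comp_norm2 n f)"
        by (rule near_diagonal_norm[OF h fm]) simp
      also have "\<dots> = L * ennreal (1 / real N)"
      proof -
        have "ennreal (2 * (1 / real N) * (C ^ k)\<^sup>2) = ennreal (2 * (C ^ k)\<^sup>2) * ennreal (1 / real N)"
          by (subst ennreal_mult[symmetric]) simp_all
        then show ?thesis by (simp add: L_def ac_simps)
      qed
      also have "\<dots> \<le> L * ennreal d"
        using N by (intro mult_left_mono ennreal_leI) auto
      finally show ?thesis using d by simp
    qed
    ultimately show "\<exists>g\<in>vclosure. fock_dist2 nu g (emb (Suc n) ?u) \<le> ennreal \<epsilon>" by blast
  qed
qed

lemma tens_power_W:
  assumes low: "\<And>j. j \<le> n \<Longrightarrow> L2S j \<subseteq> W j"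
    and h: "h \<in> B0" and f: "f \<in> L2S n"
  shows "tens (\<lambda>uv. h (fst uv) * snd uv ^ k) f \<in> W (Suc n)"
  using h f
\<comment> \<open>The time factor has to be general, because the step applies the induction
  hypothesis to cell indicators in place of \<open>h\<close>.\<close>
proof (induction k arbitrary: h f)
  case 0
  then show ?case using tens_B0_W[OF _ low] by simp
next
  case (Suc k)
  show ?case by (rule tens_power_Suc_W[OF low Suc.IH Suc.prems])
qed

lemma tens_polynomial_W:
  assumes low: "\<And>j. j \<le> n \<Longrightarrow> L2S j \<subseteq> W j"
    and h: "h \<in> B0" and f: "f \<in> L2S n" and p: "real_polynomial_function p"
  shows "tens (\<lambda>uv. h (fst uv) * p (snd uv)) f \<in> W (Suc n)"
proof -
  obtain a N where p: "p = (\<lambda>x. \<Sum>i\<le>N. a i * x ^ i)"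
    using p real_polynomial_function_iff_sum by auto
  have "(\<lambda>x. \<Sum>i\<le>N. a i * tens (\<lambda>uv. h (fst uv) * snd uv ^ i) f x) \<in> W (Suc n)"
    by (intro W_sum W_scale tens_power_W[OF low h f]) auto
  also have "(\<lambda>x. \<Sum>i\<le>N. a i * tens (\<lambda>uv. h (fst uv) * snd uv ^ i) f x) = tens (\<lambda>uv. h (fst uv) * p (snd uv)) f"
    by (simp add: p tens_def sum_distrib_left sum_distrib_right ac_simps fun_eq_iff)
  finally show ?thesis .
qed

section \<open>From powers to measurable sets\<close>

lemma tens_atMost_W:
  assumes low: "\<And>j. j \<le> n \<Longrightarrow> L2S j \<subseteq> W j"
    and h: "h \<in> B0" and f: "f \<in> L2S n"
  shows "tens (\<lambda>uv. h (fst uv) * indicator {..b} (snd uv)) f \<in> W (Suc n)"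
proof -
  have [measurable]: "h \<in> borel_measurable borel" using h by (auto simp: B0_def)
  \<comment> \<open>A ramp that equals 1 up to \<open>b\<close> and falls linearly to 0 at b + 1/(i
    + 1). At each point it eventually equals the indicator of the half-line.\<close>
  define \<phi> where "\<phi> i s = max 0 (min 1 (1 - real (Suc i) * (s - b)))" for i s
  have "\<exists>p. real_polynomial_function p \<and> (\<forall>s\<in>{-C..C}. \<bar>\<phi> i s - p s\<bar> < 1 / real (Suc i))" for i
  proof -
    have "continuous_on {-C..C} (\<phi> i)"
      unfolding \<phi>_def by (intro continuous_intros)
    from Stone_Weierstrass_real_polynomial_function[OF compact_Icc this, of "1 / real (Suc i)"]
    show ?thesis by (metis of_nat_0_less_iff zero_less_Suc zero_less_divide_1_iff)
  qed
  then obtain p where p: "\<And>i. real_polynomial_function (p i)"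
    and close: "\<And>i s. s \<in> {-C..C} \<Longrightarrow> \<bar>\<phi> i s - p i s\<bar> < 1 / real (Suc i)"
    by metis
  \<comment> \<open>The ramp contributes at most 1 and the approximation error at most 1.\<close>
  have bound: "\<bar>p i s\<bar> \<le> 2" if "\<bar>s\<bar> \<le> C" for i s
  proof -
    have "\<bar>\<phi> i s - p i s\<bar> < 1 / real (Suc i)" using that by (intro close) auto
    moreover have "1 / real (Suc i) \<le> 1" by simp
    moreover have "0 \<le> \<phi> i s" "\<phi> i s \<le> 1" by (auto simp: \<phi>_def)
    ultimately show ?thesis by linarith
  qed
  have lim: "(\<lambda>i. p i s) \<longlonglongrightarrow> indicator {..b} s" if "\<bar>s\<bar> \<le> C" for s
  proof -
    have "eventually (\<lambda>i. \<phi> i s = indicator {..b} s) sequentially"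
    proof (cases "s \<le> b")
      case True
      then have "real (Suc i) * (s - b) \<le> 0" for i
        by (intro mult_nonneg_nonpos) auto
      then show ?thesis using True by (simp add: \<phi>_def del: of_nat_Suc)
    next
      case False
      then obtain M where M: "1 < real (Suc M) * (s - b)"
        using reals_Archimedean3[of "s - b"] by (metis diff_gt_0_iff_gt linorder_not_le lift_Suc_mono_less
          mult_strict_right_mono of_nat_less_iff lessI order_less_trans)
      have "\<phi> i s = indicator {..b} s" if "M \<le> i" for i
      proof -
        have "real (Suc M) * (s - b) \<le> real (Suc i) * (s - b)"
          using that False by (intro mult_right_mono) auto
        with M have "1 - real (Suc i) * (s - b) \<le> 0" by linarith
        then show ?thesis using False by (simp add: \<phi>_def del: of_nat_Suc)
      qed
      then show ?thesis unfolding eventually_sequentially by blast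
    qed
    then have "(\<lambda>i. \<phi> i s) \<longlonglongrightarrow> indicator {..b} s"
      by (rule tendsto_eventually)
    moreover have "(\<lambda>i. \<phi> i s - p i s) \<longlonglongrightarrow> 0"
    proof (rule Lim_null_comparison)
      show "eventually (\<lambda>i. norm (\<phi> i s - p i s) \<le> 1 / real (Suc i)) sequentially"
      proof (intro always_eventually allI)
        fix i
        have "\<bar>\<phi> i s - p i s\<bar> < 1 / real (Suc i)"
          by (rule close) (use that in auto)
        then show "norm (\<phi> i s - p i s) \<le> 1 / real (Suc i)"
          by (simp only: real_norm_def less_imp_le)
      qed
      show "(\<lambda>i. 1 / real (Suc i)) \<longlonglongrightarrow> 0"
        using LIMSEQ_inverse_real_of_nat by (simp add: inverse_eq_divide)
    qed
    ultimately have "(\<lambda>i. \<phi> i s - (\<phi> i s - p i s)) \<longlonglongrightarrow> indicator {..b} s - 0"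
      by (rule tendsto_diff)
    then show ?thesis by simp
  qed
  show ?thesis
  proof (rule W_dominated)
    show "tens (\<lambda>uv. h (fst uv) * p i (snd uv)) f \<in> W (Suc n)" for i
      by (rule tens_polynomial_W[OF low h f p])
    show "tens (\<lambda>uv. h (fst uv) * indicator {..b} (snd uv)) f \<in> borel_measurable (FM nu (Suc n))"
      by (rule measurable_tens[OF _ L2S_measurable[OF f]]) measurable
    have "tens (\<lambda>uv. h (fst uv)) f \<in> W (Suc n)" by (rule tens_B0_W[OF f low h])
    note t = W_L2S[OF this]
    show "(\<lambda>x. 2 * \<bar>tens (\<lambda>uv. h (fst uv)) f x\<bar>) \<in> L2S (Suc n)"
      using L2S_measurable[OF t] by (intro L2S_scale L2S_mono_AE[OF t]) auto
    show "AE x in FM nu (Suc n). x \<in> Sset (Suc n) \<longrightarrow>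
       \<bar>tens (\<lambda>uv. h (fst uv) * p i (snd uv)) f x\<bar> \<le> 2 * \<bar>tens (\<lambda>uv. h (fst uv)) f x\<bar>" for i
      using AE_FM_head[of n]
    proof eventually_elim
      case (elim x)
      have "\<bar>p i (snd (x 0))\<bar> * \<bar>h (fst (x 0)) * f (x \<circ> Suc)\<bar> \<le> 2 * \<bar>h (fst (x 0)) * f (x \<circ> Suc)\<bar>"
        using bound[OF elim] by (intro mult_right_mono) auto
      then show ?case by (simp add: tens_def abs_mult ac_simps)
    qed
    show "AE x in FM nu (Suc n). x \<in> Sset (Suc n) \<longrightarrow>
       (\<lambda>i. tens (\<lambda>uv. h (fst uv) * p i (snd uv)) f x) \<longlonglongrightarrow> tens (\<lambda>uv. h (fst uv) * indicator {..b} (snd uv)) f x"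
      using AE_FM_head[of n]
      by eventually_elim (auto simp: tens_def intro!: tendsto_intros lim)
  qed
qed

text \<open>The weight \<open>w\<close> keeps everything square-integrable although \<open>A\<close> may have infinite measure; complements are formed by subtracting from \<open>w\<close>.\<close>

lemma W_dynkin:
  assumes w: "w \<in> W m" and X [measurable]: "X \<in> FM nu m \<rightarrow>\<^sub>M N"
    and sets_N: "sets N = sigma_sets (space N) G" and G: "Int_stable G" "G \<subseteq> Pow (space N)"
    and gen: "\<And>A. A \<in> G \<Longrightarrow> (\<lambda>x. indicator A (X x) * w x) \<in> W m"
    and A: "A \<in> sets N"
  shows "(\<lambda>x. indicator A (X x) * w x) \<in> W m"
proof -
  have wm [measurable]: "w \<in> borel_measurable (FM nu m)" by (rule W_measurable[OF w])
  have A': "A \<in> sigma_sets (space N) G" using A sets_N by simp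
  show ?thesis
    using G A'
  proof (induction rule: sigma_sets_induct_disjoint)
    case (basic A)
    then show ?case by (rule gen)
  next
    case empty
    then show ?case using W_zero by simp
  next
    case (compl A)
    then have [measurable]: "A \<in> sets N" by (simp add: sets_N)
    show ?case
    proof (rule W_cong[OF W_diff[OF w compl.IH]])
      fix x assume "x \<in> space (FM nu m)"
      then have "X x \<in> space N" by (rule measurable_space[OF X])
      then show "w x - indicator A (X x) * w x = indicator (space N - A) (X x) * w x"
        by (auto simp: indicator_def)
    qed measurable
  next
    case (union A)
    have [measurable]: "A i \<in> sets N" for i using union by (auto simp: sets_N)
    have [measurable]: "(\<Union>i. A i) \<in> sets N" by (intro sets.countable_UN) auto
    show ?case
    proof (rule W_dominated)
      show "(\<lambda>x. \<Sum>j<i. indicator (A j) (X x) * w x) \<in> W m" for i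
        using union.IH by (intro W_sum) auto
      show "(\<lambda>x. \<bar>w x\<bar>) \<in> L2S m"
        by (intro L2S_mono_AE[OF W_L2S[OF w]]) auto
      \<comment> \<open>Partial sums of disjoint indicators are indicators of partial unions, hence
        never exceed \<open>w\<close> in absolute value.\<close>
      have eq: "(\<Sum>j<i. indicator (A j) (X x) * w x) = indicator (\<Union>j<i. A j) (X x) * w x" for i x
      proof -
        have "disjoint_family_on A {..<i}"
          using union by (rule_tac disjoint_family_on_mono[of _ UNIV]) auto
        then have "indicator (\<Union>j<i. A j) (X x) = (\<Sum>j<i. indicator (A j) (X x) :: real)"
          by (intro indicator_UN_disjoint) auto
        then show ?thesis by (simp only: sum_distrib_right)
      qed
      show "AE x in FM nu m. x \<in> Sset m \<longrightarrow> \<bar>\<Sum>j<i. indicator (A j) (X x) * w x\<bar> \<le> \<bar>w x\<bar>" for i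
        unfolding eq by (auto simp: indicator_def)
      show "AE x in FM nu m. x \<in> Sset m \<longrightarrow>
          (\<lambda>i. \<Sum>j<i. indicator (A j) (X x) * w x) \<longlonglongrightarrow> indicator (\<Union>i. A i) (X x) * w x"
        unfolding eq by (intro AE_I2 impI tendsto_intros LIMSEQ_indicator_UN)
    qed measurable
  qed
qed

text \<open>Dynkin's lemma is used twice: first in the jump variable, starting from half-lines, then
  in the pair of time and jump, starting from measurable rectangles.\<close>

lemma tens_indicator_W:
  assumes low: "\<And>j. j \<le> n \<Longrightarrow> L2S j \<subseteq> W j"
    and h: "h \<in> B0" and f: "f \<in> L2S n" and A: "A \<in> sets borel"
  shows "tens (\<lambda>uv. indicator A uv * h (fst uv)) f \<in> W (Suc n)"
proof -
  have snd_indicator: "tens (\<lambda>uv. h (fst uv) * indicator B (snd uv)) f \<in> W (Suc n)"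
    if h: "h \<in> B0" and B: "B \<in> sets borel" for h :: "real \<Rightarrow> real" and B
  proof -
    have eq: "(\<lambda>x. indicator B (snd (x 0)) * tens (\<lambda>uv. h (fst uv)) f x) = tens (\<lambda>uv. h (fst uv) * indicator B (snd uv)) f" for B
      by (simp add: tens_def fun_eq_iff)
    have "(\<lambda>x. indicator B (snd (x 0)) * tens (\<lambda>uv. h (fst uv)) f x) \<in> W (Suc n)"
    proof (rule W_dynkin[where N=borel and G="range atMost"])
      show "sets borel = sigma_sets (space borel) (range atMost :: real set set)"
        by (subst borel_eq_atMost) simp
      show "Int_stable (range atMost :: real set set)"
        by (auto simp: Int_stable_def)
    qed (use B in \<open>auto simp: eq intro: tens_B0_W[OF f low h] tens_atMost_W[OF low h f]\<close>)
    then show ?thesis by (simp only: eq)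
  qed
  have "(\<lambda>x. indicator A (x 0) * tens (\<lambda>uv. h (fst uv)) f x) \<in> W (Suc n)"
  proof (rule W_dynkin[where N="borel \<Otimes>\<^sub>M borel" and X="\<lambda>x. x 0"])
    show "sets (borel \<Otimes>\<^sub>M borel) = sigma_sets (space (borel \<Otimes>\<^sub>M borel)) {A \<times> B |A B. A \<in> sets (borel::real measure) \<and> B \<in> sets (borel::real measure)}"
      by (simp add: sets_pair_measure space_pair_measure)
    show "Int_stable {A \<times> B |A B. A \<in> sets (borel::real measure) \<and> B \<in> sets (borel::real measure)}"
      by (rule Int_stable_pair_measure_generator)
    show "(\<lambda>x. x 0) \<in> FM nu (Suc n) \<rightarrow>\<^sub>M borel \<Otimes>\<^sub>M borel"
      unfolding borel_prod by (rule measurable_head_FM)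
    show "A \<in> sets (borel \<Otimes>\<^sub>M borel)"
      unfolding borel_prod by (rule A)
    show "tens (\<lambda>uv. h (fst uv)) f \<in> W (Suc n)"
      by (rule tens_B0_W[OF f low h])
    fix D assume "D \<in> {A \<times> B |A B. A \<in> sets (borel::real measure) \<and> B \<in> sets (borel::real measure)}"
    then obtain A B where D: "D = A \<times> B" "A \<in> sets borel" "B \<in> sets borel" by blast
    \<comment> \<open>The time side of the rectangle is absorbed into \<open>h\<close>, and the jump
      side is covered by the first stage.\<close>
    have "tens (\<lambda>uv. (h (fst uv) * indicator A (fst uv)) * indicator B (snd uv)) f \<in> W (Suc n)"
      by (rule snd_indicator[OF B0_mult_indicator[OF h D(2)] D(3)])
    also have "tens (\<lambda>uv. (h (fst uv) * indicator A (fst uv)) * indicator B (snd uv)) f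
      = (\<lambda>x. indicator D (x 0) * tens (\<lambda>uv. h (fst uv)) f x)"
      by (auto simp: D(1) tens_def fun_eq_iff indicator_def mem_Times_iff)
    finally show "(\<lambda>x. indicator D (x 0) * tens (\<lambda>uv. h (fst uv)) f x) \<in> W (Suc n)" .
  qed (auto simp: space_pair_measure)
  then show ?thesis by (simp add: tens_def mult.assoc)
qed

section \<open>Time cutoffs and the induction on the number of particles\<close>

definition box :: "real \<Rightarrow> nat \<Rightarrow> fpoint \<Rightarrow> real" where
  "box R n x = (\<Prod>i<n. indicator {0..R} (fst (x i)))"

lemma box_0_1: "0 \<le> box R n x" "box R n x \<le> 1"
  unfolding box_def by (auto intro: prod_nonneg prod_le_1)

lemma box_Suc: "box R (Suc n) = tens (\<lambda>uv. indicator {0..R} (fst uv)) (box R n)"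
  unfolding box_def tens_def prod.lessThan_Suc_shift by (simp add: fun_eq_iff)

text \<open>Cutting off the times suffices because the jumps carry a probability measure; each
  particle contributes the finite norm of \<open>indicator {0..R}\<close>.\<close>

lemma box_L2S: "box R n \<in> L2S n"
proof (induction n)
  case 0
  have "box R 0 = (\<lambda>x. 1)" by (simp add: box_def fun_eq_iff)
  then show ?case by (simp add: L2S_def comp_norm2_0)
next
  case (Suc n)
  have m: "box R n \<in> borel_measurable (FM nu n)" by (rule L2S_measurable[OF Suc])
  have "comp_norm2 (Suc n) (box R (Suc n)) \<le> (\<integral>\<^sup>+uv. ennreal ((indicator {0..R} (fst uv))\<^sup>2) \<partial>pM) * comp_norm2 n (box R n)"
    unfolding box_Suc by (intro comp_norm2_tens m) measurable
  also have "(\<integral>\<^sup>+uv. ennreal ((indicator {0..R} (fst uv))\<^sup>2) \<partial>pM) = B0_norm2 (indicator {0..R})"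
    unfolding B0_norm2_def by (rule nn_integral_pM_fst) simp
  also have "B0_norm2 (indicator {0..R}) * comp_norm2 n (box R n) < \<infinity>"
    using B0_norm2_finite[OF indicator_B0] Suc by (simp add: L2S_def ennreal_mult_less_top)
  finally show ?case
    using m unfolding L2S_def box_Suc by (auto intro!: measurable_tens)
qed

text \<open>Product sets generate the sigma-algebra. Their first side is handled by
  \<open>tens_indicator_W\<close>, while the remaining sides, cut off by \<open>box R n\<close>,
  form the n-particle function \<open>f\<close> there.\<close>

lemma indicator_box_W:
  assumes low: "\<And>j. j \<le> n \<Longrightarrow> L2S j \<subseteq> W j" and A: "A \<in> sets (FM nu (Suc n))"
  shows "(\<lambda>x. indicator A x * box R (Suc n) x) \<in> W (Suc n)"
proof (rule W_dynkin[where N="FM nu (Suc n)" and X="\<lambda>x. x" and G="prod_algebra {..<Suc n} (\<lambda>_. pM)"])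
  show "box R (Suc n) \<in> W (Suc n)"
    unfolding box_Suc by (rule tens_B0_W[OF box_L2S low indicator_B0])
  show "sets (FM nu (Suc n)) = sigma_sets (space (FM nu (Suc n))) (prod_algebra {..<Suc n} (\<lambda>_. pM))"
    unfolding FM_def by (simp add: sets_PiM space_PiM)
  show "Int_stable (prod_algebra {..<Suc n} (\<lambda>_. pM))"
    by (rule Int_stable_prod_algebra)
  show "prod_algebra {..<Suc n} (\<lambda>_. pM) \<subseteq> Pow (space (FM nu (Suc n)))"
    using prod_algebra_sets_into_space[of "{..<Suc n}" "\<lambda>_. pM"] by (simp add: space_FM)
  fix D assume D': "D \<in> prod_algebra {..<Suc n} (\<lambda>_. pM)"
  then obtain E where D: "D = Pi\<^sub>E {..<Suc n} E" "\<And>i. i < Suc n \<Longrightarrow> E i \<in> sets pM"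
    by (auto elim!: prod_algebraE_all)
  let ?T = "Pi\<^sub>E {..<n} (\<lambda>i. E (Suc i))"
  have T: "?T \<in> sets (FM nu n)"
    unfolding FM_def using D by (intro sets_PiM_I_finite) auto
  have f: "(\<lambda>y. indicator ?T y * box R n y) \<in> L2S n"
    using T L2S_measurable[OF box_L2S] by (intro L2S_mono_AE[OF box_L2S]) (auto simp: indicator_def)
  have "E 0 \<in> sets borel" using D(2)[of 0] by (simp add: sets_pM)
  from tens_indicator_W[OF low indicator_B0 f this]
  have "tens (\<lambda>uv. indicator (E 0) uv * indicator {0..R} (fst uv)) (\<lambda>y. indicator ?T y * box R n y) \<in> W (Suc n)" .
  then show "(\<lambda>x. indicator D x * box R (Suc n) x) \<in> W (Suc n)"
  proof (rule W_cong)
    have "D \<in> sets (FM nu (Suc n))"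
      using D' unfolding FM_def sets_PiM by (rule sigma_sets.Basic)
    then show "(\<lambda>x. indicator D x * box R (Suc n) x) \<in> borel_measurable (FM nu (Suc n))"
      using L2S_measurable[OF box_L2S] by measurable
    fix x assume "x \<in> space (FM nu (Suc n))"
    then have "x \<in> D \<longleftrightarrow> x 0 \<in> E 0 \<and> x \<circ> Suc \<in> ?T"
      by (auto simp: D(1) space_FM PiE_iff extensional_def less_Suc_eq_0_disj)
    then show "tens (\<lambda>uv. indicator (E 0) uv * indicator {0..R} (fst uv)) (\<lambda>y. indicator ?T y * box R n y) x
       = indicator D x * box R (Suc n) x"
      unfolding box_Suc by (auto simp: tens_def indicator_def)
  qed
qed (use A in auto)

lemma box_tendsto_1:
  assumes "x \<in> Sset n"
  shows "(\<lambda>i. box (real i) n x) \<longlonglongrightarrow> 1"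
proof (rule tendsto_eventually)
  \<comment> \<open>On \<open>Sset n\<close> all times are nonnegative, so a bound on their sum
    bounds each of them.\<close>
  obtain M :: nat where M: "(\<Sum>i<n. fst (x i)) \<le> real M"
    using real_arch_simple by blast
  have "box (real m) n x = 1" if "M \<le> m" for m
  proof -
    have "fst (x i) \<in> {0..real m}" if "i < n" for i
    proof -
      have "fst (x i) \<le> (\<Sum>i<n. fst (x i))"
        using assms that by (intro member_le_sum) (auto simp: Sset_def)
      with M \<open>M \<le> m\<close> assms that show ?thesis by (auto simp: Sset_def)
    qed
    then show ?thesis by (simp add: box_def)
  qed
  then show "eventually (\<lambda>i. box (real i) n x = 1) sequentially"
    unfolding eventually_sequentially by blast
qed

text \<open>The factor \<^term>\<open>box\<close> makes the level sets of the approximating simple functions have finite measure.\<close>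

lemma L2S_subset_W_Suc:
  assumes low: "\<And>j. j \<le> n \<Longrightarrow> L2S j \<subseteq> W j"
  shows "L2S (Suc n) \<subseteq> W (Suc n)"
proof
  fix u assume u: "u \<in> L2S (Suc n)"
  have um: "u \<in> borel_measurable (FM nu (Suc n))" by (rule L2S_measurable[OF u])
  obtain F where F: "\<And>i. simple_function (FM nu (Suc n)) (F i)"
    and lim: "\<And>x. x \<in> space (FM nu (Suc n)) \<Longrightarrow> (\<lambda>i. F i x) \<longlonglongrightarrow> u x"
    and bound: "\<And>i x. x \<in> space (FM nu (Suc n)) \<Longrightarrow> dist (F i x) 0 \<le> 2 * dist (u x) 0"
    using borel_measurable_implies_sequence_metric[OF um, of 0] by blast
  show "u \<in> W (Suc n)"
  proof (rule W_dominated[OF _ um])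
    \<comment> \<open>The cutoff radius grows with the index of the simple function, so one sequence
      serves both limits.\<close>
    show "(\<lambda>x. F i x * box (real i) (Suc n) x) \<in> W (Suc n)" for i
    proof (rule W_cong)
      let ?S = "F i ` space (FM nu (Suc n))"
      let ?A = "\<lambda>y. F i -` {y} \<inter> space (FM nu (Suc n))"
      have fin: "finite ?S" by (rule simple_functionD(1)[OF F])
      show "(\<lambda>x. \<Sum>y\<in>?S. y * (indicator (?A y) x * box (real i) (Suc n) x)) \<in> W (Suc n)"
        by (intro W_sum fin W_scale indicator_box_W[OF low] simple_functionD(2)[OF F])
      show "(\<lambda>x. F i x * box (real i) (Suc n) x) \<in> borel_measurable (FM nu (Suc n))"
        by (intro borel_measurable_times borel_measurable_simple_function[OF F] L2S_measurable[OF box_L2S])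
      fix x assume x: "x \<in> space (FM nu (Suc n))"
      have "(\<Sum>y\<in>?S. y * (indicator (?A y) x * box (real i) (Suc n) x)) = (\<Sum>y\<in>?S. if y = F i x then y * box (real i) (Suc n) x else 0)"
        using x by (intro sum.cong) (auto simp: indicator_def)
      then show "(\<Sum>y\<in>?S. y * (indicator (?A y) x * box (real i) (Suc n) x)) = F i x * box (real i) (Suc n) x"
        using fin x by (simp add: sum.delta)
    qed
    show "(\<lambda>x. 2 * \<bar>u x\<bar>) \<in> L2S (Suc n)"
      using um by (intro L2S_scale L2S_mono_AE[OF u]) auto
    show "AE x in FM nu (Suc n). x \<in> Sset (Suc n) \<longrightarrow> \<bar>F i x * box (real i) (Suc n) x\<bar> \<le> 2 * \<bar>u x\<bar>" for i
    proof (intro AE_I2 impI)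
      fix x assume "x \<in> space (FM nu (Suc n))"
      from bound[OF this, of i] have "\<bar>F i x\<bar> * \<bar>box (real i) (Suc n) x\<bar> \<le> (2 * \<bar>u x\<bar>) * 1"
        using box_0_1[of "real i" "Suc n" x] by (intro mult_mono) auto
      then show "\<bar>F i x * box (real i) (Suc n) x\<bar> \<le> 2 * \<bar>u x\<bar>" by (simp add: abs_mult)
    qed
    show "AE x in FM nu (Suc n). x \<in> Sset (Suc n) \<longrightarrow> (\<lambda>i. F i x * box (real i) (Suc n) x) \<longlonglongrightarrow> u x"
    proof (intro AE_I2 impI)
      fix x assume "x \<in> space (FM nu (Suc n))" "x \<in> Sset (Suc n)"
      from tendsto_mult[OF lim[OF this(1)] box_tendsto_1[OF this(2)]]
      show "(\<lambda>i. F i x * box (real i) (Suc n) x) \<longlonglongrightarrow> u x" by simp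
    qed
  qed
qed

text \<open>The induction is strong because subtracting lower components uses every smaller number
  of particles.\<close>

lemma L2S_subset_W: "L2S n \<subseteq> W n"
proof (induction n rule: less_induct)
  case (less n)
  then show ?case
    using W_0 L2S_subset_W_Suc by (cases n) (auto simp: less_Suc_eq_le)
qed

text \<open>Truncations to finitely many components are already in the closure, and the squared
  error of a truncation is the tail of a convergent series.\<close>

lemma vacuum_cyclic:
  assumes f: "f \<in> fock nu"
  shows "f \<in> vclosure"
proof (rule vclosure_closed[OF f])
  fix \<epsilon> :: real assume "0 < \<epsilon>"
  define r where "r n = enn2real (comp_norm2 n (f n))" for n
  have r_nonneg: "0 \<le> r n" for n by (simp add: r_def)
  have r: "ennreal (r n) = comp_norm2 n (f n)" for n
    using component_L2S[OF f, of n] by (simp add: r_def L2S_def)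
  have "(\<Sum>n. ennreal (r n)) \<noteq> \<infinity>"
    using f by (auto simp: r fock_iff fock_norm2_def)
  then have summ: "summable r"
    by (intro summable_suminf_not_top r_nonneg) simp
  then obtain N where N: "norm (\<Sum>i. r (i + N)) < \<epsilon>"
    using suminf_exist_split[OF \<open>0 < \<epsilon>\<close> summ] by blast
  let ?g = "\<lambda>n x. if n < N then f n x else 0"
  have "?g \<in> fock nu"
  proof -
    have "fock_norm2 ?g \<le> fock_norm2 f"
      unfolding fock_norm2_def by (intro suminf_le comp_norm2_mono_AE) auto
    moreover have "?g n \<in> borel_measurable (FM nu n)" for n
      using fock_measurable[OF f, of n] by (cases "n < N") auto
    ultimately show ?thesis using f by (auto simp: fock_iff)
  qed
  then have "?g \<in> vclosure"
    by (rule lower_components_vclosure[OF _ L2S_subset_W, of _ N]) auto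
  moreover have "fock_dist2 nu ?g f \<le> ennreal \<epsilon>"
  proof -
    have "comp_norm2 n (\<lambda>x. ?g n x - f n x) = (if n < N then 0 else ennreal (r n))" for n
      using comp_norm2_scale[OF fock_measurable[OF f], of n "-1"] by (auto simp: r)
    then have "fock_dist2 nu ?g f = (\<Sum>n. if n < N then 0 else ennreal (r n))"
      by (simp add: fock_dist2_eq fock_norm2_def)
    also have "\<dots> = (\<Sum>n. ennreal (r (n + N)))"
      by (subst suminf_offset[of _ N]) auto
    also have "\<dots> = ennreal (\<Sum>n. r (n + N))"
      using summ r_nonneg by (intro suminf_ennreal2) (auto simp: summable_iff_shift)
    also have "\<dots> \<le> ennreal \<epsilon>"
      using N by (intro ennreal_leI) auto
    finally show ?thesis .
  qed
  ultimately show "\<exists>g\<in>vclosure. fock_dist2 nu g f \<le> ennreal \<epsilon>" by blast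
qed

end

theorem theorem3p1:
  fixes nu :: "real measure"
  assumes "prob_space nu"
    and "sets nu = sets borel"
    and "\<exists>C. emeasure nu {s. \<bar>s\<bar> > C} = 0"
  shows "\<forall>f \<in> fock nu. \<forall>\<epsilon>>0. \<exists>P \<in> op_alg nu. fock_dist2 nu (P vacuum) f < ennreal \<epsilon>"
proof -
  obtain C where C: "emeasure nu {s. \<bar>s\<bar> > C} = 0" using assms(3) by blast
  interpret prob_space nu by (rule assms(1))
  \<comment> \<open>The given bound is an arbitrary real; \<open>max 0 C\<close> still bounds the
    jumps and is nonnegative, as the locale asks.\<close>
  have "monotone_fock nu (max 0 C)"
  proof (intro monotone_fock.intro monotone_fock_axioms.intro assms(1,2))
    have "{s. \<bar>s\<bar> > C} \<in> null_sets nu"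
      using C assms(2) by (intro null_setsI) auto
    then show "AE s in nu. \<bar>s\<bar> \<le> max 0 C"
      by (rule AE_I') auto
  qed simp
  then interpret monotone_fock nu "max 0 C" .
  show ?thesis
    using vacuum_cyclic by (auto simp: vclosure_def)
qed

end
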